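(* Let $d\ge 2$, let $K\subset\mathbb{R}^d$ be a convex body with center at the point $0\in K$, and let $\gamma\ge 0$. Let $Z=\{Z(x,t):\ x\in\mathbb{R}^d,\ t\in\mathbb{R}\}$ be a measurable, mean-square continuous Gaussian random field, homogeneous and isotropic in space and stationary in time, with $\mathbb{E}[Z(x,t)]=0$, $\mathbb{E}[Z^2(x,t)]=1$ and $\mathbb{E}[Z(x,t)Z(y,s)]=C(\|x-y\|,|t-s|)\ge 0$. For each $T>0$ let $G_T\in L_2(\mathbb{R},\phi(z)\,dz)$, and put $\mathcal{J}_q(T)=\int_{\mathbb{R}}G_T(z)H_q(z)\phi(z)\,dz$ for $q\ge 0$. Assume that for every $T>0$ the function $G_T$ has Hermite rank $m\ge 1$ (with $m$ not depending on $T$), i.e. $\mathcal{J}_m(T)\neq 0$ and $\mathcal{J}_q(T)=0$ for $1\le q\le m-1$. Let $A(T)=\int_0^T\int_{T^\gamma K}G_T(Z(x,t))\,dx\,dt$ and assume that $$\limsup_{T\to\infty}\frac{\operatorname{Var}(A(T))}{\frac{\mathcal{J}_m^2(T)}{(m!)^2}\,\sigma_{m,T^\gamma K}^2(T)}\le 1 .$$ Then $$Y(T)=\frac{A(T)-\mathbb{E}[A(T)]}{|\mathcal{J}_m(T)|\,\sigma_{m,T^\gamma K}(T)/m!}\qquad\text{and}\qquad Y_m(T)=\frac{\operatorname{sgn}(\mathcal{J}_m(T))\int_0^T\int_{T^\gamma K}H_m(Z(x,t))\,dx\,dt}{\sigma_{m,T^\gamma K}(T)}$$ have the same limiting distributions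 as $T\to\infty$ (if one of them exists).
   Context: A convex body in $\mathbb{R}^d$ is a compact convex set with non-empty interior. $T^\gamma K$ is the homothetic image of $K$ with center $0$ and scaling factor $T^\gamma$. $\phi(w)=\frac{1}{\sqrt{2\pi}}e^{-w^2/2}$ is the standard normal density. $H_n$ is the Hermite polynomial of order $n$ defined by $\frac{d^n}{dz^n}\phi(z)=(-1)^nH_n(z)\phi(z)$ (so $H_0=1$, $H_1(z)=z$, $H_2(z)=z^2-1$). Integrals of the random field are understood in the mean-square sense. For $q\ge 1$, $$\sigma_{q,T^\gamma K}^2(T)=\operatorname{Var}\Big(\int_0^T\int_{T^\gamma K}H_q(Z(x,t))\,dx\,dt\Big)=2\,q!\,T\int_0^T\Big(1-\frac{\tau}{T}\Big)\int_{T^\gamma K\times T^\gamma K}C^q(\|x-y\|,\tau)\,dx\,dy\,d\tau,$$ where $C^q$ is the $q$-th power of $C$. *)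

theory Defs
  imports "HOL-Probability.Probability"
begin

definition convex_body :: "'a::euclidean_space set \<Rightarrow> bool" where
  "convex_body K \<longleftrightarrow> compact K \<and> convex K \<and> interior K \<noteq> {}"

definition space_time_region :: "'a::euclidean_space set \<Rightarrow> real \<Rightarrow> real \<Rightarrow> ('a \<times> real) set" where
  "space_time_region K \<gamma> T = ((\<lambda>x. (T powr \<gamma>) *\<^sub>R x) ` K) \<times> {0..T}"


definition hermite :: "nat \<Rightarrow> real \<Rightarrow> real" where
  "hermite n z = (-1) ^ n * (deriv ^^ n) std_normal_density z / std_normal_density z"

lemma deriv_std_normal_density_hermite:
  "(deriv ^^ n) std_normal_density z = (-1) ^ n * hermite n z * std_normal_density z"
proof -
  have "std_normal_density z \<noteq> 0"
    by (simp add: normal_density_def)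
  moreover have "(-1 :: real) ^ n * (-1) ^ n = 1"
    by (simp flip: power_mult_distrib)
  ultimately show ?thesis
    by (simp add: hermite_def)
qed

text \<open>Elements of \<open>L\<^sub>2(\<real>, \<phi>(z) dz)\<close> are given by Borel representatives.\<close>

definition L2_gauss :: "(real \<Rightarrow> real) \<Rightarrow> bool" where
  "L2_gauss g \<longleftrightarrow> g \<in> borel_measurable borel \<and>
     integrable lborel (\<lambda>z. (g z)\<^sup>2 * std_normal_density z)"

definition hermite_coeff :: "(real \<Rightarrow> real) \<Rightarrow> nat \<Rightarrow> real" where
  "hermite_coeff g q = (LINT z|lborel. g z * hermite q z * std_normal_density z)"

definition has_hermite_rank :: "(real \<Rightarrow> real) \<Rightarrow> nat \<Rightarrow> bool" where
  "has_hermite_rank g m \<longleftrightarrow>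
     hermite_coeff g m \<noteq> 0 \<and> (\<forall>q. 1 \<le> q \<and> q \<le> m - 1 \<longrightarrow> hermite_coeff g q = 0)"


text \<open>A random field is a family \<open>Z\<close> of functions on the probability space \<open>M\<close>.  A Gaussian
  random variable may be degenerate (almost surely constant).\<close>

definition gaussian_rv :: "'w measure \<Rightarrow> ('w \<Rightarrow> real) \<Rightarrow> bool" where
  "gaussian_rv M X \<longleftrightarrow> X \<in> borel_measurable M \<and>
     ((\<exists>c. AE \<omega> in M. X \<omega> = c) \<or>
      (\<exists>\<mu> \<sigma>. \<sigma> > 0 \<and> distributed M lborel X (normal_density \<mu> \<sigma>)))"

definition gaussian_field :: "'w measure \<Rightarrow> ('p \<Rightarrow> 'w \<Rightarrow> real) \<Rightarrow> bool" where
  "gaussian_field M Z \<longleftrightarrow>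
     (\<forall>I a. finite I \<longrightarrow> gaussian_rv M (\<lambda>\<omega>. \<Sum>p\<in>I. a p * Z p \<omega>))"

definition measurable_field ::
    "'w measure \<Rightarrow> ('p::topological_space \<Rightarrow> 'w \<Rightarrow> real) \<Rightarrow> bool" where
  "measurable_field M Z \<longleftrightarrow> (\<lambda>(p, \<omega>). Z p \<omega>) \<in> borel_measurable (borel \<Otimes>\<^sub>M M)"

definition ms_continuous_field ::
    "'w measure \<Rightarrow> ('p::topological_space \<Rightarrow> 'w \<Rightarrow> real) \<Rightarrow> bool" where
  "ms_continuous_field M Z \<longleftrightarrow>
     (\<forall>p. Z p \<in> borel_measurable M \<and> integrable M (\<lambda>\<omega>. (Z p \<omega>)\<^sup>2)) \<and>
     (\<forall>p. ((\<lambda>q. LINT \<omega>|M. (Z q \<omega> - Z p \<omega>)\<^sup>2) \<longlongrightarrow> 0) (at p))"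

definition fin_dim_distr ::
    "'w measure \<Rightarrow> ('p \<Rightarrow> 'w \<Rightarrow> real) \<Rightarrow> 'p set \<Rightarrow> ('p \<Rightarrow> real) measure" where
  "fin_dim_distr M Z I = distr M (\<Pi>\<^sub>M p\<in>I. borel) (\<lambda>\<omega>. \<lambda>p\<in>I. Z p \<omega>)"

definition law_invariant :: "'w measure \<Rightarrow> ('p \<Rightarrow> 'w \<Rightarrow> real) \<Rightarrow> ('p \<Rightarrow> 'p) \<Rightarrow> bool" where
  "law_invariant M Z g \<longleftrightarrow>
     (\<forall>I. finite I \<longrightarrow> fin_dim_distr M (\<lambda>p. Z (g p)) I = fin_dim_distr M Z I)"

definition homogeneous_in_space ::
    "'w measure \<Rightarrow> ('a::euclidean_space \<times> real \<Rightarrow> 'w \<Rightarrow> real) \<Rightarrow> bool" where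
  "homogeneous_in_space M Z \<longleftrightarrow> (\<forall>h. law_invariant M Z (\<lambda>(x, t). (x + h, t)))"

definition isotropic_in_space ::
    "'w measure \<Rightarrow> ('a::euclidean_space \<times> real \<Rightarrow> 'w \<Rightarrow> real) \<Rightarrow> bool" where
  "isotropic_in_space M Z \<longleftrightarrow>
     (\<forall>f. orthogonal_transformation f \<longrightarrow> law_invariant M Z (\<lambda>(x, t). (f x, t)))"

definition stationary_in_time ::
    "'w measure \<Rightarrow> ('a::euclidean_space \<times> real \<Rightarrow> 'w \<Rightarrow> real) \<Rightarrow> bool" where
  "stationary_in_time M Z \<longleftrightarrow> (\<forall>h. law_invariant M Z (\<lambda>(x, t). (x, t + h)))"


text \<open>The mean-square integral of a second-order field \<open>Y\<close> over a bounded set \<open>S\<close> is the limit in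
  \<open>L\<^sub>2(M)\<close> of its integral sums over finite Borel partitions \<open>P\<close> of \<open>S\<close> with tags \<open>c B \<in> B\<close>, as the
  mesh tends to 0.  It is determined up to a null set; \<open>ms_integral\<close> picks a version.\<close>

definition has_ms_integral ::
    "'w measure \<Rightarrow> ('p::euclidean_space \<Rightarrow> 'w \<Rightarrow> real) \<Rightarrow> 'p set \<Rightarrow> ('w \<Rightarrow> real) \<Rightarrow> bool" where
  "has_ms_integral M Y S X \<longleftrightarrow>
     (\<forall>p\<in>S. Y p \<in> borel_measurable M \<and> integrable M (\<lambda>\<omega>. (Y p \<omega>)\<^sup>2)) \<and>
     X \<in> borel_measurable M \<and> integrable M (\<lambda>\<omega>. (X \<omega>)\<^sup>2) \<and>
     (\<forall>\<epsilon>>0. \<exists>\<delta>>0. \<forall>P c.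
        finite P \<and> partition_on S P \<and> (\<forall>B\<in>P. B \<in> sets borel \<and> diameter B < \<delta> \<and> c B \<in> B) \<longrightarrow>
        (LINT \<omega>|M. (X \<omega> - (\<Sum>B\<in>P. measure lborel B * Y (c B) \<omega>))\<^sup>2) < \<epsilon>)"

definition ms_integral ::
    "'w measure \<Rightarrow> ('p::euclidean_space \<Rightarrow> 'w \<Rightarrow> real) \<Rightarrow> 'p set \<Rightarrow> 'w \<Rightarrow> real" where
  "ms_integral M Y S = (SOME X. has_ms_integral M Y S X)"

text \<open>\<open>\<integral>\<^sub>0\<^sup>T \<integral>\<^bsub>T\<^sup>\<gamma> K\<^esub> g (Z (x, t)) dx dt\<close> is the mean-square integral over the product region
  \<open>T\<^sup>\<gamma> K \<times> [0, T]\<close>.\<close>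

definition field_functional ::
    "'w measure \<Rightarrow> ('a::euclidean_space \<times> real \<Rightarrow> 'w \<Rightarrow> real) \<Rightarrow> 'a set \<Rightarrow> real \<Rightarrow>
     (real \<Rightarrow> real) \<Rightarrow> real \<Rightarrow> 'w \<Rightarrow> real" where
  "field_functional M Z K \<gamma> g T =
     ms_integral M (\<lambda>p \<omega>. g (Z p \<omega>)) (space_time_region K \<gamma> T)"

definition hermite_variance ::
    "'w measure \<Rightarrow> ('a::euclidean_space \<times> real \<Rightarrow> 'w \<Rightarrow> real) \<Rightarrow> 'a set \<Rightarrow> real \<Rightarrow>
     nat \<Rightarrow> real \<Rightarrow> real" where
  "hermite_variance M Z K \<gamma> q T =
     prob_space.variance M (field_functional M Z K \<gamma> (hermite q) T)"


text \<open>Convergence in distribution along an arbitrary filter; \<open>weak_conv\<close> covers only sequences.\<close>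

definition weak_conv_filter ::
    "('i \<Rightarrow> real measure) \<Rightarrow> real measure \<Rightarrow> 'i filter \<Rightarrow> bool" where
  "weak_conv_filter \<mu> \<nu> F \<longleftrightarrow>
     (\<forall>x. isCont (cdf \<nu>) x \<longrightarrow> ((\<lambda>i. cdf (\<mu> i) x) \<longlongrightarrow> cdf \<nu> x) F)"

definition same_limit_distributions ::
    "'w measure \<Rightarrow> (real \<Rightarrow> 'w \<Rightarrow> real) \<Rightarrow> (real \<Rightarrow> 'w \<Rightarrow> real) \<Rightarrow> bool" where
  "same_limit_distributions M X Y \<longleftrightarrow>
     (\<forall>\<nu>. real_distribution \<nu> \<longrightarrow>
        (weak_conv_filter (\<lambda>T. distr M borel (X T)) \<nu> at_top \<longleftrightarrow>
         weak_conv_filter (\<lambda>T. distr M borel (Y T)) \<nu> at_top))"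

end

theory Submission
  imports Defs
begin

text \<open>Let \<open>H\<close> be the integral of \<open>H\<^sub>m(Z)\<close> and \<open>\<kappa> = J\<^sub>m / m!\<close>.  For a standard Gaussian pair \<open>(U, V)\<close>
  with correlation \<open>\<rho>\<close> one has \<open>E (h(U) H\<^sub>m(V)) = \<rho>\<^sup>m J\<^sub>m(h)\<close>.  This vanishes for \<open>h = G - \<kappa> H\<^sub>m\<close>,
  and passing to the limit in Riemann sums makes \<open>A - \<kappa> H\<close> orthogonal to \<open>H\<close>.  Hence
  \<open>E (Y - Y\<^sub>m)\<^sup>2 = Var A / (\<kappa>\<^sup>2 \<sigma>\<^sup>2) - 1\<close>, which tends to \<open>0\<close> by the assumption on the upper limit, and
  variables that are close in \<open>L\<^sub>2\<close> have the same limiting distributions.\<close>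

subsection \<open>Square-integrable functions and convergence in distribution\<close>

text \<open>Two obstacles shape the argument. A Gaussian pair with correlation 1 or -1 has no joint
  density, and such pairs do occur, since the two points in a double Riemann sum may coincide. The
  correlation formula is therefore derived from characteristic functions, which treat all
  correlations alike. Uniqueness enters for a signed weight: if \<open>U\<close> integrates to 0
  against every \<open>exp (i s X)\<close>, it does so against every function of \<open>X\<close>
  for which the product is integrable.

  The other obstacle is that \<open>ms_integral\<close> is a choice and says nothing until an
  integral is known to exist. The function \<open>G\<^sub>T\<close> is merely square-integrable
  against \<phi>, so the mean-square continuity of \<open>Z\<close> does not pass to
  \<open>G\<^sub>T(Z)\<close> by composition. It does for Lipschitz functions, and these are dense
  in \<open>L\<^sub>2(\<phi>)\<close>. As every \<open>Z p\<close> has the law \<phi>, replacing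
  \<open>G\<^sub>T\<close> by a Lipschitz function costs the same at all points, which keeps the
  continuity uniform.\<close>

definition sq_integrable :: "'a measure \<Rightarrow> ('a \<Rightarrow> real) \<Rightarrow> bool" where
  "sq_integrable M f \<longleftrightarrow> f \<in> borel_measurable M \<and> integrable M (\<lambda>x. (f x)\<^sup>2)"

lemma sq_integrable_measurable: "sq_integrable M f \<Longrightarrow> f \<in> borel_measurable M"
  and sq_integrable_square: "sq_integrable M f \<Longrightarrow> integrable M (\<lambda>x. (f x)\<^sup>2)"
  by (simp_all add: sq_integrable_def)

lemma integrable_mult_sq_integrable:
  assumes "sq_integrable M f" "sq_integrable M g"
  shows "integrable M (\<lambda>x. f x * g x)"
proof (rule Bochner_Integration.integrable_bound)
  show "integrable M (\<lambda>x. (f x)\<^sup>2 + (g x)\<^sup>2)"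
    using assms by (simp add: sq_integrable_def)
  have "\<bar>a * b\<bar> \<le> a\<^sup>2 + b\<^sup>2" for a b :: real
  proof -
    have "2 * (\<bar>a\<bar> * \<bar>b\<bar>) \<le> a\<^sup>2 + b\<^sup>2"
      using sum_squares_bound[of "\<bar>a\<bar>" "\<bar>b\<bar>"] by simp
    moreover have "0 \<le> \<bar>a\<bar> * \<bar>b\<bar>" by simp
    ultimately show ?thesis by (simp only: abs_mult)
  qed
  then show "AE x in M. norm (f x * g x) \<le> norm ((f x)\<^sup>2 + (g x)\<^sup>2)"
    by simp
qed (use assms in \<open>auto simp: sq_integrable_def\<close>)

lemma sq_integrable_cmult: "sq_integrable M f \<Longrightarrow> sq_integrable M (\<lambda>x. c * f x)"
  by (auto simp: sq_integrable_def power_mult_distrib)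

lemma sq_integrable_add:
  assumes "sq_integrable M f" "sq_integrable M g"
  shows "sq_integrable M (\<lambda>x. f x + g x)"
  using assms integrable_mult_sq_integrable[OF assms]
  by (auto simp: sq_integrable_def power2_sum mult.assoc)

lemma sq_integrable_diff:
  assumes "sq_integrable M f" "sq_integrable M g"
  shows "sq_integrable M (\<lambda>x. f x - g x)"
  using sq_integrable_add[OF assms(1) sq_integrable_cmult[OF assms(2), of "-1"]] by simp

lemma sq_integrable_sum:
  assumes "\<And>i. i \<in> I \<Longrightarrow> sq_integrable M (f i)"
  shows "sq_integrable M (\<lambda>x. \<Sum>i\<in>I. f i x)"
  using assms
proof (induction I rule: infinite_finite_induct)
  case (insert i I)
  then show ?case by (simp add: sq_integrable_add)
qed (simp_all add: sq_integrable_def)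

lemma (in finite_measure) sq_integrable_const: "sq_integrable M (\<lambda>_. c)"
  by (simp add: sq_integrable_def)

lemma (in finite_measure) sq_integrable_imp_integrable: "sq_integrable M f \<Longrightarrow> integrable M f"
  by (auto simp: sq_integrable_def intro: square_integrable_imp_integrable)

text \<open>The integral of \<open>(B f - P g)\<^sup>2\<close> is \<open>B\<^sup>2\<close> times the
  squared distance of \<open>f\<close> from its projection onto \<open>g\<close>; this scaling
  avoids dividing by \<open>B\<close>, which may be 0.\<close>

lemma integral_Cauchy_Schwarz:
  assumes f: "sq_integrable M f" and g: "sq_integrable M g"
  shows "(LINT x|M. f x * g x)\<^sup>2 \<le> (LINT x|M. (f x)\<^sup>2) * (LINT x|M. (g x)\<^sup>2)"
proof -
  define P B where "P = (LINT x|M. f x * g x)" and "B = (LINT x|M. (g x)\<^sup>2)"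
  note [measurable] = sq_integrable_measurable[OF f] sq_integrable_measurable[OF g]
  note i = sq_integrable_square[OF f] sq_integrable_square[OF g] integrable_mult_sq_integrable[OF f g]
  have "0 \<le> (LINT x|M. (B * f x - P * g x)\<^sup>2)"
    by simp
  also have "\<dots> = (LINT x|M. B\<^sup>2 * (f x)\<^sup>2 - 2 * B * P * (f x * g x) + P\<^sup>2 * (g x)\<^sup>2)"
    by (simp add: power2_diff algebra_simps power_mult_distrib)
  also have "\<dots> = B\<^sup>2 * (LINT x|M. (f x)\<^sup>2) - 2 * B * P * P + P\<^sup>2 * B"
    unfolding P_def B_def using i by simp
  also have "\<dots> = B * ((LINT x|M. (f x)\<^sup>2) * B - P\<^sup>2)"
    by (simp add: power2_eq_square algebra_simps)
  finally have *: "0 \<le> B * ((LINT x|M. (f x)\<^sup>2) * B - P\<^sup>2)" .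
  have "B \<ge> 0" unfolding B_def by simp
  show ?thesis
  proof (cases "B = 0")
    case True
    then have "AE x in M. (g x)\<^sup>2 = 0"
      unfolding B_def using i by (subst (asm) integral_nonneg_eq_0_iff_AE) auto
    then have "P = (LINT x|M. 0)"
      unfolding P_def by (intro integral_cong_AE) auto
    then show ?thesis by (simp add: P_def)
  next
    case False
    with \<open>B \<ge> 0\<close> have "B > 0" by simp
    with * show ?thesis
      by (simp add: P_def[symmetric] B_def[symmetric] zero_le_mult_iff)
  qed
qed

text \<open>Continuity of the inner product, in the form in which orthogonality passes from Riemann
  sums to mean-square integrals: the approximants may depend on \<epsilon> and need only be
  orthogonal to each other.\<close>

lemma integral_mult_eq_0_by_L2_approximation:
  assumes U: "sq_integrable M U" and V: "sq_integrable M V"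
    and approx: "\<And>\<epsilon>. \<epsilon> > 0 \<Longrightarrow> \<exists>U' V'. sq_integrable M U' \<and> sq_integrable M V' \<and>
      (LINT x|M. (U x - U' x)\<^sup>2) < \<epsilon> \<and> (LINT x|M. (V x - V' x)\<^sup>2) < \<epsilon> \<and> (LINT x|M. U' x * V' x) = 0"
  shows "(LINT x|M. U x * V x) = 0"
proof (rule ccontr)
  define a where "a = \<bar>LINT x|M. U x * V x\<bar>"
  define u v where "u = sqrt (LINT x|M. (U x)\<^sup>2)" and "v = sqrt (LINT x|M. (V x)\<^sup>2)"
  assume "(LINT x|M. U x * V x) \<noteq> 0"
  then have "a > 0" by (simp add: a_def)
  have uv: "u \<ge> 0" "v \<ge> 0" by (simp_all add: u_def v_def)
  \<comment> \<open>The error is below \<open>r v + u r + r\<^sup>2\<close>. With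
    \<open>r \<le> 1\<close> the last term is at most \<open>r\<close>, so
    \<open>r (u + v + 1) \<le> a\<close> suffices for a contradiction.\<close>
  define r where "r = min 1 (a / (u + v + 1))"
  have r: "0 < r" "r \<le> 1" "r * (u + v + 1) \<le> a"
    using \<open>a > 0\<close> uv by (auto simp: r_def min_def divide_simps mult.commute)
  obtain U' V' where U': "sq_integrable M U'" and V': "sq_integrable M V'"
    and dU: "(LINT x|M. (U x - U' x)\<^sup>2) < r\<^sup>2" and dV: "(LINT x|M. (V x - V' x)\<^sup>2) < r\<^sup>2"
    and 0: "(LINT x|M. U' x * V' x) = 0"
    using approx[of "r\<^sup>2"] r by auto
  note D = sq_integrable_diff[OF U U'] sq_integrable_diff[OF V V']
  have CS: "\<bar>LINT x|M. f x * g x\<bar> \<le> sqrt (LINT x|M. (f x)\<^sup>2) * sqrt (LINT x|M. (g x)\<^sup>2)"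
    if "sq_integrable M f" "sq_integrable M g" for f g
    using real_sqrt_le_mono[OF integral_Cauchy_Schwarz[OF that]] by (simp add: real_sqrt_mult)
  have sU: "sqrt (LINT x|M. (U x - U' x)\<^sup>2) < r" and sV: "sqrt (LINT x|M. (V x - V' x)\<^sup>2) < r"
    using dU dV r real_sqrt_less_mono[OF dU] real_sqrt_less_mono[OF dV] by simp_all
  have nn: "0 \<le> sqrt (LINT x|M. (U x - U' x)\<^sup>2)" "0 \<le> sqrt (LINT x|M. (V x - V' x)\<^sup>2)"
    by simp_all
  have "(LINT x|M. U x * V x) = (LINT x|M. (U x - U' x) * V x + U x * (V x - V' x)
      - (U x - U' x) * (V x - V' x) + U' x * V' x)"
    by (simp add: algebra_simps)
  also have "\<dots> = (LINT x|M. (U x - U' x) * V x) + (LINT x|M. U x * (V x - V' x))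
      - (LINT x|M. (U x - U' x) * (V x - V' x))"
    using integrable_mult_sq_integrable[OF D(1) V] integrable_mult_sq_integrable[OF U D(2)]
      integrable_mult_sq_integrable[OF D] integrable_mult_sq_integrable[OF U' V'] 0 by simp
  finally have "a \<le> sqrt (LINT x|M. (U x - U' x)\<^sup>2) * v + u * sqrt (LINT x|M. (V x - V' x)\<^sup>2)
      + sqrt (LINT x|M. (U x - U' x)\<^sup>2) * sqrt (LINT x|M. (V x - V' x)\<^sup>2)"
    unfolding a_def u_def v_def using CS[OF D(1) V] CS[OF U D(2)] CS[OF D] by linarith
  also have "\<dots> < r * v + u * r + r * 1"
  proof -
    have "sqrt (LINT x|M. (U x - U' x)\<^sup>2) * v \<le> r * v" "u * sqrt (LINT x|M. (V x - V' x)\<^sup>2) \<le> u * r"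
      using sU sV uv by (auto intro: mult_right_mono mult_left_mono)
    moreover have "sqrt (LINT x|M. (U x - U' x)\<^sup>2) * sqrt (LINT x|M. (V x - V' x)\<^sup>2) < r * 1"
      using mult_strict_mono'[OF sU sV nn] mult_left_le[of r r] r by linarith
    ultimately show ?thesis by linarith
  qed
  also have "\<dots> \<le> a" using r(3) by (simp add: algebra_simps)
  finally show False by simp
qed

text \<open>On the event \<open>Y \<le> x\<close> either \<open>X \<le> y\<close> or
  \<open>X\<close> and \<open>Y\<close> differ by at least \<open>y - x\<close>; Chebyshev's
  inequality bounds the probability of the latter.\<close>

lemma (in prob_space) cdf_distr_le_cdf_distr_shift:
  assumes X: "X \<in> borel_measurable M" and Y: "Y \<in> borel_measurable M"
    and D: "sq_integrable M (\<lambda>\<omega>. X \<omega> - Y \<omega>)" and "x < y"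
  shows "cdf (distr M borel Y) x \<le> cdf (distr M borel X) y + expectation (\<lambda>\<omega>. (X \<omega> - Y \<omega>)\<^sup>2) / (y - x)\<^sup>2"
proof -
  note [measurable] = X Y
  have "cdf (distr M borel Y) x = prob {\<omega>\<in>space M. Y \<omega> \<le> x}"
    by (simp add: cdf_def measure_distr vimage_def Int_def conj_commute)
  also have "\<dots> \<le> prob ({\<omega>\<in>space M. X \<omega> \<le> y} \<union> {\<omega>\<in>space M. \<bar>X \<omega> - Y \<omega>\<bar> \<ge> y - x})"
    by (rule finite_measure_mono) (use \<open>x < y\<close> in auto)
  also have "\<dots> \<le> prob {\<omega>\<in>space M. X \<omega> \<le> y} + prob {\<omega>\<in>space M. \<bar>X \<omega> - Y \<omega>\<bar> \<ge> y - x}"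
    by (rule measure_Un_le) auto
  also have "prob {\<omega>\<in>space M. X \<omega> \<le> y} = cdf (distr M borel X) y"
    by (simp add: cdf_def measure_distr vimage_def Int_def conj_commute)
  also have "prob {\<omega>\<in>space M. \<bar>X \<omega> - Y \<omega>\<bar> \<ge> y - x} \<le> expectation (\<lambda>\<omega>. (X \<omega> - Y \<omega>)\<^sup>2) / (y - x)\<^sup>2"
    using D \<open>x < y\<close> by (intro second_moment_method) (auto simp: sq_integrable_def)
  finally show ?thesis by simp
qed

text \<open>A monotone function has at most countably many discontinuities, while an interval is
  uncountable.\<close>

lemma (in real_distribution) isCont_cdf_between:
  assumes "a < b"
  shows "\<exists>c. a < c \<and> c < b \<and> isCont (cdf M) c"
proof -
  have "countable {c. \<not> isCont (cdf M) c}"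
    by (rule mono_ctble_discont) (auto simp: mono_def cdf_nondecreasing)
  moreover have "uncountable {a<..<b}"
    using assms by (simp add: uncountable_open_interval)
  ultimately have "\<not> {a<..<b} \<subseteq> {c. \<not> isCont (cdf M) c}"
    using countable_subset by blast
  then show ?thesis by auto
qed

text \<open>A Slutsky argument. The cdf of \<open>X i\<close> is controlled only at continuity
  points of the limit, so the cdf of \<open>Y i\<close> at \<open>x\<close> is squeezed between
  those of \<open>X i\<close> at continuity points \<open>a < x < b\<close> near \<open>x\<close>. A
  third of \<epsilon> each goes to the oscillation of \<open>cdf \<nu>\<close>, the convergence at
  \<open>a\<close> and \<open>b\<close>, and the Chebyshev error.\<close>

lemma (in prob_space) weak_conv_filter_L2_close:
  assumes meas: "\<forall>\<^sub>F i in F. X i \<in> borel_measurable M \<and> Y i \<in> borel_measurable M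
      \<and> sq_integrable M (\<lambda>\<omega>. X i \<omega> - Y i \<omega>)"
    and lim: "((\<lambda>i. expectation (\<lambda>\<omega>. (X i \<omega> - Y i \<omega>)\<^sup>2)) \<longlongrightarrow> 0) F"
    and \<nu>: "real_distribution \<nu>"
    and conv: "weak_conv_filter (\<lambda>i. distr M borel (X i)) \<nu> F"
  shows "weak_conv_filter (\<lambda>i. distr M borel (Y i)) \<nu> F"
  unfolding weak_conv_filter_def
proof (intro allI impI tendstoI)
  fix x and \<epsilon> :: real assume cont: "isCont (cdf \<nu>) x" and "\<epsilon> > 0"
  interpret \<nu>: real_distribution \<nu> by fact
  obtain \<delta> where "\<delta> > 0" and \<delta>: "\<And>y. \<bar>y - x\<bar> < \<delta> \<Longrightarrow> \<bar>cdf \<nu> y - cdf \<nu> x\<bar> < \<epsilon> / 3"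
    using cont[unfolded continuous_at_eps_delta dist_real_def, rule_format, of "\<epsilon> / 3"] \<open>\<epsilon> > 0\<close>
    by auto
  obtain a where a: "x - \<delta> < a" "a < x" "isCont (cdf \<nu>) a"
    using \<nu>.isCont_cdf_between[of "x - \<delta>" x] \<open>\<delta> > 0\<close> by auto
  obtain b where b: "x < b" "b < x + \<delta>" "isCont (cdf \<nu>) b"
    using \<nu>.isCont_cdf_between[of x "x + \<delta>"] \<open>\<delta> > 0\<close> by auto
  define E where "E i = expectation (\<lambda>\<omega>. (X i \<omega> - Y i \<omega>)\<^sup>2)" for i
  have E: "((\<lambda>i. E i / c) \<longlongrightarrow> 0) F" for c
    using tendsto_divide_0[OF lim, of "\<lambda>_. c"] tendsto_mult_left_zero[OF lim, of "inverse c"]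
    by (simp add: E_def field_simps)
  have ev: "\<forall>\<^sub>F i in F. E i / (b - x)\<^sup>2 < \<epsilon> / 3" "\<forall>\<^sub>F i in F. E i / (x - a)\<^sup>2 < \<epsilon> / 3"
    using \<open>\<epsilon> > 0\<close> by (intro order_tendstoD(2)[OF E], simp)+
  have "\<forall>\<^sub>F i in F. \<bar>cdf (distr M borel (X i)) c - cdf \<nu> c\<bar> < \<epsilon> / 3" if "isCont (cdf \<nu>) c" for c
    using conv that \<open>\<epsilon> > 0\<close> tendstoD[of "\<lambda>i. cdf (distr M borel (X i)) c" "cdf \<nu> c" F "\<epsilon> / 3"]
    by (simp add: weak_conv_filter_def dist_real_def)
  note this[OF a(3)] this[OF b(3)]
  with ev meas show "\<forall>\<^sub>F i in F. dist (cdf (distr M borel (Y i)) x) (cdf \<nu> x) < \<epsilon>"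
  proof eventually_elim
    case (elim i)
    have D: "sq_integrable M (\<lambda>\<omega>. Y i \<omega> - X i \<omega>)"
      using sq_integrable_cmult[of M "\<lambda>\<omega>. X i \<omega> - Y i \<omega>" "-1"] elim by simp
    have "cdf (distr M borel (Y i)) x \<le> cdf (distr M borel (X i)) b + E i / (b - x)\<^sup>2"
      unfolding E_def using elim b by (intro cdf_distr_le_cdf_distr_shift) auto
    moreover have "cdf (distr M borel (X i)) a \<le> cdf (distr M borel (Y i)) x + E i / (x - a)\<^sup>2"
      using cdf_distr_le_cdf_distr_shift[of "Y i" "X i" a x] elim a D
      unfolding E_def by (simp add: power2_commute[of "Y i _"])
    moreover have "\<bar>cdf \<nu> a - cdf \<nu> x\<bar> < \<epsilon> / 3" "\<bar>cdf \<nu> b - cdf \<nu> x\<bar> < \<epsilon> / 3"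
      using a b \<delta>[of a] \<delta>[of b] by auto
    ultimately show ?case
      using elim unfolding dist_real_def by linarith
  qed
qed

subsection \<open>Uniqueness for characteristic functions\<close>

text \<open>The image under \<open>X\<close> of the signed measure with density \<open>U\<close> has
  zero Fourier transform, hence is zero. Levy's theorem speaks of probability measures, so the
  positive and negative parts of \<open>U\<close> are normalised by their common mass
  \<open>c\<close>; if \<open>c = 0\<close>, then \<open>U\<close> vanishes almost everywhere. The
  codomain of \<open>g\<close> is general because both real and complex integrands occur.\<close>

lemma (in prob_space) integral_eq_0_if_char_eq_0:
  fixes U X :: "'a \<Rightarrow> real" and g :: "real \<Rightarrow> 'b::{banach, second_countable_topology}"
  assumes U: "integrable M U" and X[measurable]: "X \<in> borel_measurable M"
    and char: "\<And>s. (LINT \<omega>|M. U \<omega> *\<^sub>R iexp (s * X \<omega>)) = 0"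
    and g[measurable]: "g \<in> borel_measurable borel"
    and int: "integrable M (\<lambda>\<omega>. U \<omega> *\<^sub>R g (X \<omega>))"
  shows "(LINT \<omega>|M. U \<omega> *\<^sub>R g (X \<omega>)) = 0"
proof -
  have [measurable]: "U \<in> borel_measurable M" using U by simp
  define P N where "P \<omega> = max 0 (U \<omega>)" and "N \<omega> = max 0 (- U \<omega>)" for \<omega>
  have PN: "U \<omega> = P \<omega> - N \<omega>" "0 \<le> P \<omega>" "0 \<le> N \<omega>" for \<omega>
    by (auto simp: P_def N_def)
  have iP: "integrable M P" and iN: "integrable M N"
    using U by (auto simp: P_def[abs_def] N_def[abs_def])
  note [measurable] = borel_measurable_integrable[OF iP] borel_measurable_integrable[OF iN]
  define c where "c = expectation P"
  \<comment> \<open>The hypothesis at frequency 0 says that the two parts of \<open>U\<close> have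
    equal mass.\<close>
  have "complex_of_real (expectation U) = 0"
    using char[of 0] by (simp add: scaleR_conv_of_real)
  moreover have "expectation U = expectation P - expectation N"
    using iP iN by (simp add: Bochner_Integration.integral_cong[OF refl PN(1)])
  ultimately have c': "c = expectation N"
    by (simp add: c_def)
  show ?thesis
  proof (cases "c = 0")
    case True
    then have "AE \<omega> in M. P \<omega> = 0" "AE \<omega> in M. N \<omega> = 0"
      using integral_nonneg_eq_0_iff_AE[OF iP] integral_nonneg_eq_0_iff_AE[OF iN] PN c'
      by (auto simp: c_def)
    then have "AE \<omega> in M. U \<omega> *\<^sub>R g (X \<omega>) = 0"
      by eventually_elim (simp add: PN(1))
    then have "(LINT \<omega>|M. U \<omega> *\<^sub>R g (X \<omega>)) = (LINT \<omega>|M. 0)"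
      by (intro integral_cong_AE) auto
    then show ?thesis by simp
  next
    case False
    have "c \<ge> 0" unfolding c_def using PN by simp
    with False have "c > 0" by simp
    \<comment> \<open>The law of \<open>X\<close> under the probability density
      \<open>V / c\<close>, to be used for \<open>V = P\<close> and \<open>V = N\<close>.\<close>
    define D where "D V = distr (density M (\<lambda>\<omega>. ennreal (V \<omega> / c))) borel X" for V
    have D: "real_distribution (D V)"
      and intD: "f \<in> borel_measurable borel \<Longrightarrow> (LINT x|D V. f x) = (LINT \<omega>|M. (V \<omega> / c) *\<^sub>R f (X \<omega>))"
      if iV: "integrable M V" and V: "\<And>\<omega>. 0 \<le> V \<omega>" and EV: "expectation V = c"
      for V and f :: "real \<Rightarrow> 'c::{banach, second_countable_topology}"
    proof -
      note [measurable] = borel_measurable_integrable[OF iV]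
      have "(\<integral>\<^sup>+\<omega>. ennreal (V \<omega> / c) \<partial>M) = 1"
        using iV V EV \<open>c > 0\<close> by (subst nn_integral_eq_integral) auto
      then have "prob_space (density M (\<lambda>\<omega>. ennreal (V \<omega> / c)))"
        by (intro prob_spaceI) (simp add: emeasure_density cong: nn_integral_cong)
      then show "real_distribution (D V)"
        unfolding D_def by (rule prob_space.real_distribution_distr) simp
      show "(LINT x|D V. f x) = (LINT \<omega>|M. (V \<omega> / c) *\<^sub>R f (X \<omega>))"
        if [measurable]: "f \<in> borel_measurable borel"
        unfolding D_def using V \<open>c > 0\<close> by (simp add: integral_distr integral_density)
    qed
    have eP: "expectation P = c" and eN: "expectation N = c" by (simp_all add: c_def c'[symmetric])
    have split: "(LINT \<omega>|M. U \<omega> *\<^sub>R f (X \<omega>)) = c *\<^sub>R ((LINT x|D P. f x) - (LINT x|D N. f x))"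
      if [measurable]: "f \<in> borel_measurable borel" and "integrable M (\<lambda>\<omega>. U \<omega> *\<^sub>R f (X \<omega>))"
      for f :: "real \<Rightarrow> 'c::{banach, second_countable_topology}"
    proof -
      have "integrable M (\<lambda>\<omega>. P \<omega> *\<^sub>R f (X \<omega>))" "integrable M (\<lambda>\<omega>. N \<omega> *\<^sub>R f (X \<omega>))"
        by (rule Bochner_Integration.integrable_bound[OF that(2)];
            auto simp: P_def N_def intro!: mult_right_mono)+
      then have diff: "(LINT \<omega>|M. U \<omega> *\<^sub>R f (X \<omega>)) = (LINT \<omega>|M. P \<omega> *\<^sub>R f (X \<omega>)) - (LINT \<omega>|M. N \<omega> *\<^sub>R f (X \<omega>))"
        by (simp add: PN(1) scaleR_left_diff_distrib)
      have scale: "(LINT \<omega>|M. V \<omega> *\<^sub>R f (X \<omega>)) = c *\<^sub>R (LINT \<omega>|M. (V \<omega> / c) *\<^sub>R f (X \<omega>))" for V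
        using \<open>c > 0\<close> by (simp flip: integral_scaleR_right)
      show ?thesis
        by (simp only: diff scale[of P] scale[of N] intD[OF iP PN(2) eP that(1)]
            intD[OF iN PN(3) eN that(1)] scaleR_right_diff_distrib)
    qed
    have "char (D P) = char (D N)"
    proof
      fix s
      have "integrable M (\<lambda>\<omega>. U \<omega> *\<^sub>R iexp (s * X \<omega>))"
        by (rule Bochner_Integration.integrable_bound[OF U]) auto
      then have "c *\<^sub>R (char (D P) s - char (D N) s) = 0"
        unfolding char_def using split[of "\<lambda>x. iexp (s * x)"] char[of s] by simp
      with \<open>c > 0\<close> show "char (D P) s = char (D N) s" by simp
    qed
    then have "D P = D N"
      using D iP iN PN eP eN by (intro Levy_uniqueness) auto
    with split[OF g int] show ?thesis by simp
  qed
qed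

section \<open>Centred Gaussian variables, degenerate ones included\<close>

lemma (in prob_space) gaussian_rv_char:
  assumes R: "gaussian_rv M R" and mean: "expectation R = 0"
  shows "(CLINT \<omega>|M. iexp (R \<omega>)) = of_real (exp (- expectation (\<lambda>\<omega>. (R \<omega>)\<^sup>2) / 2))"
proof -
  have [measurable]: "R \<in> borel_measurable M" using R by (simp add: gaussian_rv_def)
  consider c where "AE \<omega> in M. R \<omega> = c" | \<mu> \<sigma> where "\<sigma> > 0" "distributed M lborel R (normal_density \<mu> \<sigma>)"
    using R by (auto simp: gaussian_rv_def)
  then show ?thesis
  proof cases
    case 1
    then have "expectation R = (LINT \<omega>|M. c)"
      by (intro integral_cong_AE) auto
    \<comment> \<open>An almost surely constant variable with mean 0 is almost surely 0, and both
      sides of the formula are 1.\<close>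
    with mean have "c = 0" by (simp add: prob_space)
    have "(CLINT \<omega>|M. iexp (R \<omega>)) = (CLINT \<omega>|M. 1)" "expectation (\<lambda>\<omega>. (R \<omega>)\<^sup>2) = (LINT \<omega>|M. 0)"
      using 1 \<open>c = 0\<close> by (intro integral_cong_AE; auto)+
    then show ?thesis by (simp add: prob_space)
  next
    case 2
    then have "\<mu> = 0" using mean normal_distributed_expectation by metis
    have var: "expectation (\<lambda>\<omega>. (R \<omega>)\<^sup>2) = \<sigma>\<^sup>2"
      using normal_distributed_variance[OF 2] mean by simp
    have "distributed M lborel (\<lambda>\<omega>. R \<omega> / \<sigma>) std_normal_density"
      using 2 normal_standard_normal_convert[of \<sigma> R \<mu>] \<open>\<mu> = 0\<close> by simp
    then have "distr M lborel (\<lambda>\<omega>. R \<omega> / \<sigma>) = std_normal_distribution"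
      by (rule distributed_distr_eq_density)
    then have D: "distr M borel (\<lambda>\<omega>. R \<omega> / \<sigma>) = std_normal_distribution"
      by (metis distr_cong sets_lborel)
    have "(CLINT \<omega>|M. iexp (R \<omega>)) = (CLINT \<omega>|M. iexp (\<sigma> * (R \<omega> / \<sigma>)))"
      using 2 by simp
    also have "\<dots> = char (distr M borel (\<lambda>\<omega>. R \<omega> / \<sigma>)) \<sigma>"
      unfolding char_def by (subst integral_distr) auto
    also have "\<dots> = of_real (exp (- \<sigma>\<^sup>2 / 2))"
      by (simp add: D char_std_normal_distribution)
    finally show ?thesis by (simp add: var)
  qed
qed

text \<open>Unit second moment rules out the degenerate alternative in \<open>gaussian_rv\<close>,
  so a normal density exists, and its two parameters are read off from the moments.\<close>

lemma (in prob_space) gaussian_rv_standard: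
  assumes R: "gaussian_rv M R" and mean: "expectation R = 0" and var: "expectation (\<lambda>\<omega>. (R \<omega>)\<^sup>2) = 1"
  shows "distr M borel R = std_normal_distribution"
proof -
  have [measurable]: "R \<in> borel_measurable M" using R by (simp add: gaussian_rv_def)
  have "\<not> (AE \<omega> in M. R \<omega> = c)" for c
  proof
    assume *: "AE \<omega> in M. R \<omega> = c"
    then have "expectation R = (LINT \<omega>|M. c)"
      by (intro integral_cong_AE) auto
    with mean have "c = 0" by (simp add: prob_space)
    have "expectation (\<lambda>\<omega>. (R \<omega>)\<^sup>2) = (LINT \<omega>|M. 0)"
      using * \<open>c = 0\<close> by (intro integral_cong_AE; auto)+
    with var show False by simp
  qed
  then obtain \<mu> \<sigma> where 2: "\<sigma> > 0" "distributed M lborel R (normal_density \<mu> \<sigma>)"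
    using R by (auto simp: gaussian_rv_def)
  then have "\<mu> = 0" using mean normal_distributed_expectation by metis
  have "\<sigma>\<^sup>2 = 1"
    using normal_distributed_variance[OF 2] mean var by simp
  with 2 have "\<sigma> = 1" by (simp add: power2_eq_1_iff)
  have "distr M lborel R = std_normal_distribution"
    using distributed_distr_eq_density[OF 2(2)] \<open>\<mu> = 0\<close> \<open>\<sigma> = 1\<close> by simp
  then show ?thesis
    by (metis distr_cong sets_lborel)
qed

subsection \<open>Hermite polynomials\<close>

text \<open>The quotient in \<open>hermite\<close> hides that it is a polynomial. The recursion
  comes from \<open>(p \<phi>)' = (p' - z p) \<phi>\<close>, the alternating sign being absorbed by
  the factor \<open>(-1)\<^sup>n\<close>.\<close>

fun hermite_poly :: "nat \<Rightarrow> real poly" where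
  "hermite_poly 0 = 1"
| "hermite_poly (Suc n) = [:0, 1:] * hermite_poly n - pderiv (hermite_poly n)"

lemma std_normal_density_has_derivative:
  "(std_normal_density has_real_derivative - z * std_normal_density z) (at z)"
  unfolding std_normal_density_def[abs_def]
  by (auto intro!: derivative_eq_intros simp: field_simps)

lemma poly_std_normal_density_has_derivative:
  "((\<lambda>z. poly p z * std_normal_density z) has_real_derivative
     poly (pderiv p - [:0, 1:] * p) z * std_normal_density z) (at z)"
  by (auto intro!: derivative_eq_intros std_normal_density_has_derivative poly_DERIV simp: algebra_simps)

lemma deriv_std_normal_density_hermite_poly:
  "(deriv ^^ n) std_normal_density = (\<lambda>z. (-1) ^ n * poly (hermite_poly n) z * std_normal_density z)"
proof (induction n)
  case (Suc n)
  have "((\<lambda>z. (-1) ^ n * poly (hermite_poly n) z * std_normal_density z) has_real_derivative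
      (-1) ^ n * (poly (pderiv (hermite_poly n) - [:0, 1:] * hermite_poly n) z * std_normal_density z)) (at z)" for z
    using DERIV_cmult[OF poly_std_normal_density_has_derivative[of "hermite_poly n" z], of "(-1) ^ n"]
    by (simp add: mult.assoc)
  then have "deriv (\<lambda>z. (-1) ^ n * poly (hermite_poly n) z * std_normal_density z) =
    (\<lambda>z. (-1) ^ n * (poly (pderiv (hermite_poly n) - [:0, 1:] * hermite_poly n) z * std_normal_density z))"
    by (intro ext DERIV_imp_deriv)
  then show ?case
    by (simp add: Suc fun_eq_iff algebra_simps)
qed simp

lemma hermite_eq_poly: "hermite n = poly (hermite_poly n)"
proof
  fix z
  have "std_normal_density z > 0" by (simp add: normal_density_pos)
  moreover have "(-1 :: real) ^ n * (-1) ^ n = 1"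
    by (simp flip: power_mult_distrib)
  ultimately show "hermite n z = poly (hermite_poly n) z"
    unfolding hermite_def deriv_std_normal_density_hermite_poly by simp
qed

text \<open>The Appell property. Differentiating the recursion and inserting the induction
  hypothesis leaves \<open>H\<^sub>n\<^sub>+\<^sub>1\<close> plus \<open>n + 1\<close> times
  \<open>z H\<^sub>n - H\<^sub>n'\<close>, which is again
  \<open>H\<^sub>n\<^sub>+\<^sub>1\<close>.\<close>

lemma pderiv_hermite_poly: "pderiv (hermite_poly (Suc n)) = smult (real (Suc n)) (hermite_poly n)"
proof (induction n)
  case 0
  then show ?case by (simp add: pderiv_pCons)
next
  case (Suc n)
  have "pderiv (hermite_poly (Suc (Suc n))) =
      hermite_poly (Suc n) + [:0, 1:] * pderiv (hermite_poly (Suc n)) - pderiv (pderiv (hermite_poly (Suc n)))"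
    by (subst hermite_poly.simps(2)) (simp only: pderiv_diff pderiv_mult pderiv_pCons, simp)
  also have "\<dots> = hermite_poly (Suc n) + smult (real (Suc n)) ([:0, 1:] * hermite_poly n - pderiv (hermite_poly n))"
    by (simp only: Suc pderiv_smult) (simp add: smult_diff_right)
  also have "\<dots> = smult (real (Suc (Suc n))) (hermite_poly (Suc n))"
  proof -
    have "real (Suc (Suc n)) = 1 + real (Suc n)" by simp
    then show ?thesis
      by (simp only: hermite_poly.simps(2)[symmetric] smult_add_left smult_1_left)
  qed
  finally show ?case .
qed

lemma borel_measurable_poly[measurable]: "poly (p :: real poly) \<in> borel_measurable borel"
  by (intro borel_measurable_continuous_onI continuous_on_poly continuous_on_id)

lemma integrable_poly_std_normal: "integrable lborel (\<lambda>z. poly p z * std_normal_density z)"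
proof -
  have "integrable lborel (\<lambda>z. \<Sum>i\<le>degree p. coeff p i * (std_normal_density z * z ^ i))"
    by (intro Bochner_Integration.integrable_sum integrable_mult_right integrable_std_normal_moment)
  then show ?thesis
    by (simp add: poly_altdef sum_distrib_left mult_ac)
qed

text \<open>The density depends on \<open>z\<close> only through \<open>z\<^sup>2 / 2\<close>, so a
  hypothesis on this quantity covers both ends of the line at once.\<close>

lemma tendsto_poly_std_normal:
  assumes "filterlim (\<lambda>z::real. z\<^sup>2 / 2) at_top F"
  shows "((\<lambda>z. poly p z * std_normal_density z) \<longlongrightarrow> 0) F"
proof -
  have lim: "((\<lambda>z. 2 ^ k * ((z\<^sup>2 / 2) ^ k / exp (z\<^sup>2 / 2))) \<longlongrightarrow> 0) F" for k
    using tendsto_mult[OF tendsto_const filterlim_compose[OF tendsto_power_div_exp_0[of k] assms], of "2 ^ k"]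
    by simp
  have "((\<lambda>z. z ^ k * std_normal_density z) \<longlongrightarrow> 0) F" for k
  proof (rule Lim_null_comparison)
    \<comment> \<open>An odd power is not a power of \<open>z\<^sup>2\<close>; this bound reduces it
      to \<open>1\<close> and \<open>(z\<^sup>2)\<^sup>k\<close>, to which the limit of
      \<open>x\<^sup>k / exp x\<close> at \<open>x = z\<^sup>2 / 2\<close> applies.\<close>
    have *: "\<bar>z\<bar> ^ k \<le> 1 + (z\<^sup>2) ^ k" for z :: real
    proof -
      have "0 \<le> (\<bar>z\<bar> ^ k - 1)\<^sup>2" by simp
      then have "2 * \<bar>z\<bar> ^ k \<le> 1 + (\<bar>z\<bar> ^ k)\<^sup>2"
        by (simp add: power2_diff)
      moreover have "(\<bar>z\<bar> ^ k)\<^sup>2 = (z\<^sup>2) ^ k"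
        by (metis power_mult mult.commute power2_abs)
      moreover have "0 \<le> \<bar>z\<bar> ^ k" by simp
      ultimately show ?thesis by linarith
    qed
    show "\<forall>\<^sub>F z in F. norm (z ^ k * std_normal_density z) \<le>
        2 ^ 0 * ((z\<^sup>2 / 2) ^ 0 / exp (z\<^sup>2 / 2)) + 2 ^ k * ((z\<^sup>2 / 2) ^ k / exp (z\<^sup>2 / 2))"
    proof (rule always_eventually, rule allI)
      fix z :: real
      have "1 \<le> sqrt (2 * pi)" using pi_ge_two by (simp add: real_le_rsqrt)
      then have "std_normal_density z \<le> exp (- z\<^sup>2 / 2)"
        by (simp add: std_normal_density_def field_simps)
      then have "\<bar>z\<bar> ^ k * std_normal_density z \<le> (1 + (z\<^sup>2) ^ k) * exp (- z\<^sup>2 / 2)"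
        using *[of z] by (intro mult_mono) auto
      then show "norm (z ^ k * std_normal_density z) \<le>
        2 ^ 0 * ((z\<^sup>2 / 2) ^ 0 / exp (z\<^sup>2 / 2)) + 2 ^ k * ((z\<^sup>2 / 2) ^ k / exp (z\<^sup>2 / 2))"
        by (simp add: abs_mult power_abs exp_minus power_divide field_simps)
    qed
    show "((\<lambda>z. 2 ^ 0 * ((z\<^sup>2 / 2) ^ 0 / exp (z\<^sup>2 / 2)) + 2 ^ k * ((z\<^sup>2 / 2) ^ k / exp (z\<^sup>2 / 2))) \<longlongrightarrow> 0) F"
      using tendsto_add[OF lim[of 0] lim[of k]] by simp
  qed
  then have "((\<lambda>z. \<Sum>i\<le>degree p. coeff p i * (z ^ i * std_normal_density z)) \<longlongrightarrow> 0) F"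
    by (intro tendsto_null_sum tendsto_mult_right_zero)
  then show ?thesis
    by (simp add: poly_altdef sum_distrib_left mult_ac)
qed

lemma filterlim_square_half_at_top: "filterlim (\<lambda>z::real. z\<^sup>2 / 2) at_top at_top"
proof (rule filterlim_at_top_mono[OF filterlim_ident])
  have "z \<le> z\<^sup>2 / 2" if "z \<ge> 2" for z :: real
    using mult_right_mono[OF that, of z] that by (simp add: power2_eq_square)
  then show "\<forall>\<^sub>F z::real in at_top. z \<le> z\<^sup>2 / 2"
    by (auto simp: eventually_at_top_linorder)
qed

lemma filterlim_square_half_at_bot: "filterlim (\<lambda>z::real. z\<^sup>2 / 2) at_top at_bot"
  using filterlim_square_half_at_top by (simp add: filterlim_at_bot_mirror)

section \<open>Fourier transforms of polynomials times the Gaussian density\<close>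

lemma integral_derivative_eq_0:
  fixes F F' :: "real \<Rightarrow> 'a::euclidean_space"
  assumes deriv: "\<And>x. (F has_vector_derivative F' x) (at x)"
    and cont: "\<And>x. isCont F' x"
    and int: "integrable lborel F'"
    and lim: "(F \<longlongrightarrow> 0) at_bot" "(F \<longlongrightarrow> 0) at_top"
  shows "(LINT x|lborel. F' x) = 0"
proof -
  have "(LBINT x=-\<infinity>..\<infinity>. F' x) = 0 - 0"
    by (rule interval_integral_FTC_integrable[where F = F])
      (use assms in \<open>auto simp: set_integrable_def ereal_tendsto_simps\<close>)
  then show ?thesis
    by (simp add: interval_lebesgue_integral_def set_lebesgue_integral_def)
qed

text \<open>At \<open>s = 0\<close> this is the Gaussian mean of \<open>p\<close>, so a single
  integration by parts yields both the characteristic functions and the orthogonality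
  relations.\<close>

definition gauss_fourier :: "real poly \<Rightarrow> real \<Rightarrow> complex" where
  "gauss_fourier p s = (CLINT z|lborel. of_real (poly p z * std_normal_density z) * iexp (s * z))"

lemma integrable_gauss_fourier:
  "integrable lborel (\<lambda>z. of_real (poly p z * std_normal_density z) * iexp (s * z))"
proof (rule Bochner_Integration.integrable_bound[OF integrable_poly_std_normal[of p]])
  show "(\<lambda>z. of_real (poly p z * std_normal_density z) * iexp (s * z)) \<in> borel_measurable lborel"
    by measurable
qed (simp add: norm_mult abs_mult)

text \<open>The integrand is the derivative of \<open>p \<phi> e\<^sup>i\<^sup>s\<^sup>z\<close>, which vanishes at infinity.\<close>

lemma gauss_fourier_by_parts:
  "gauss_fourier ([:0, 1:] * p - pderiv p) s = \<i> * s * gauss_fourier p s"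
proof -
  define F where "F z = of_real (poly p z * std_normal_density z) * iexp (s * z)" for z
  define F' where "F' z = \<i> * s * (of_real (poly p z * std_normal_density z) * iexp (s * z))
     - of_real (poly ([:0, 1:] * p - pderiv p) z * std_normal_density z) * iexp (s * z)" for z
  have "(F has_vector_derivative F' z) (at z)" for z
  proof -
    have 1: "((\<lambda>z. complex_of_real (poly p z * std_normal_density z)) has_vector_derivative
        of_real (poly (pderiv p - [:0, 1:] * p) z * std_normal_density z)) (at z)"
      by (intro has_vector_derivative_of_real poly_std_normal_density_has_derivative)
    have "((\<lambda>z. exp (\<i> * (of_real s * of_real z))) has_vector_derivative \<i> * s * iexp (s * z)) (at z)"
      by (rule has_vector_derivative_real_field[where f = "\<lambda>w. exp (\<i> * (of_real s * w))"])
        (auto intro!: derivative_eq_intros)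
    then have 2: "((\<lambda>z. iexp (s * z)) has_vector_derivative \<i> * s * iexp (s * z)) (at z)"
      by simp
    show ?thesis
      unfolding F_def F'_def using has_vector_derivative_mult[OF 1 2]
      by (simp add: algebra_simps)
  qed
  moreover have "isCont F' z" for z
    unfolding F'_def std_normal_density_def by (intro continuous_intros) auto
  moreover have int: "integrable lborel F'"
    unfolding F'_def by (intro Bochner_Integration.integrable_diff integrable_mult_right integrable_gauss_fourier)
  moreover have lim: "(F \<longlongrightarrow> 0) L" if "filterlim (\<lambda>z::real. z\<^sup>2 / 2) at_top L" for L
  proof (rule tendsto_norm_zero_cancel)
    show "((\<lambda>z. norm (F z)) \<longlongrightarrow> 0) L"
      using tendsto_norm_zero[OF tendsto_poly_std_normal[OF that, of p]]
      by (simp add: F_def norm_mult abs_mult)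
  qed
  ultimately have "(LINT z|lborel. F' z) = 0"
    by (intro integral_derivative_eq_0[of F] lim filterlim_square_half_at_top filterlim_square_half_at_bot)
  moreover have "(LINT z|lborel. F' z) = \<i> * s * gauss_fourier p s - gauss_fourier ([:0, 1:] * p - pderiv p) s"
    unfolding F'_def gauss_fourier_def
    by (subst Bochner_Integration.integral_diff)
      (intro integrable_mult_right integrable_gauss_fourier, rule integrable_gauss_fourier, simp only: integral_mult_right_zero)
  ultimately show ?thesis by simp
qed

text \<open>The map from \<open>p\<close> to \<open>z p - p'\<close>, which generates the Hermite
  polynomials, becomes multiplication by \<open>i s\<close> under the transform; the start is the
  standard normal characteristic function.\<close>

lemma gauss_fourier_hermite_poly:
  "gauss_fourier (hermite_poly n) s = (\<i> * s) ^ n * of_real (exp (- s\<^sup>2 / 2))"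
proof (induction n)
  case 0
  have "(CLINT z|std_normal_distribution. iexp (s * z)) = of_real (exp (- s\<^sup>2 / 2))"
    using char_std_normal_distribution by (simp add: char_def fun_eq_iff)
  then show ?case
    by (simp add: gauss_fourier_def integral_density scaleR_conv_of_real)
next
  case (Suc n)
  then show ?case by (simp only: hermite_poly.simps gauss_fourier_by_parts) simp
qed

lemma gauss_fourier_0: "gauss_fourier p 0 = of_real (LINT z|lborel. poly p z * std_normal_density z)"
  by (simp add: gauss_fourier_def flip: of_real_mult)

text \<open>Gaussian integration by parts: the difference of the two polynomials is
  \<open>z q - q'\<close> for \<open>q = p H\<^sub>n\<close>, whose transform vanishes at frequency
  0.\<close>

lemma integral_poly_mult_hermite_poly_Suc:
  "(LINT z|lborel. poly (p * hermite_poly (Suc n)) z * std_normal_density z) =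
   (LINT z|lborel. poly (pderiv p * hermite_poly n) z * std_normal_density z)"
proof -
  have "p * hermite_poly (Suc n) - pderiv p * hermite_poly n =
      [:0, 1:] * (p * hermite_poly n) - pderiv (p * hermite_poly n)"
    by (simp add: pderiv_mult algebra_simps)
  then have "(LINT z|lborel. poly (p * hermite_poly (Suc n) - pderiv p * hermite_poly n) z * std_normal_density z) = 0"
    using gauss_fourier_0 gauss_fourier_by_parts[of "p * hermite_poly n" 0] by simp
  then show ?thesis
    using integrable_poly_std_normal[of "p * hermite_poly (Suc n)"]
      integrable_poly_std_normal[of "pderiv p * hermite_poly n"]
    by (simp add: left_diff_distrib del: poly_mult hermite_poly.simps)
qed

text \<open>Integration by parts lowers one factor and differentiates the other, so the squared norm
  gains the factor \<open>n + 1\<close> at each step. This norm is the origin of the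
  \<open>m!\<close> in the normalisation.\<close>

lemma hermite_coeff_hermite: "hermite_coeff (hermite n) n = fact n"
proof (induction n)
  case 0
  then show ?case by (simp add: hermite_coeff_def hermite_eq_poly)
next
  case (Suc n)
  have "hermite_coeff (hermite (Suc n)) (Suc n) =
      (LINT z|lborel. poly (hermite_poly (Suc n) * hermite_poly (Suc n)) z * std_normal_density z)"
    by (simp add: hermite_coeff_def hermite_eq_poly del: hermite_poly.simps)
  also have "\<dots> = (LINT z|lborel. real (Suc n) * (poly (hermite_poly n * hermite_poly n) z * std_normal_density z))"
    unfolding integral_poly_mult_hermite_poly_Suc pderiv_hermite_poly by (simp add: mult_ac)
  also have "\<dots> = real (Suc n) * fact n"
    using Suc by (simp add: hermite_coeff_def hermite_eq_poly)
  finally show ?case by simp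
qed

lemma integral_hermite_eq_0:
  assumes "n \<ge> 1"
  shows "(LINT z|lborel. hermite n z * std_normal_density z) = 0"
proof -
  obtain k where "n = Suc k" using assms by (cases n) auto
  then show ?thesis
    using integral_poly_mult_hermite_poly_Suc[of 1 k] by (simp add: hermite_eq_poly del: hermite_poly.simps)
qed

lemma L2_gauss_poly: "L2_gauss (poly p)"
  using integrable_poly_std_normal[of "p * p"]
  by (simp add: L2_gauss_def power2_eq_square borel_measurable_continuous_onI continuous_on_poly)

subsection \<open>Standard Gaussian pairs\<close>

lemma L2_gauss_hermite: "L2_gauss (hermite n)"
  unfolding hermite_eq_poly by (rule L2_gauss_poly)

context prob_space
begin

lemma standard_normal_integral:
  fixes f :: "real \<Rightarrow> 'b::{banach, second_countable_topology}"
  assumes X: "X \<in> borel_measurable M" "distr M borel X = std_normal_distribution"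
    and f[measurable]: "f \<in> borel_measurable borel"
  shows "(LINT \<omega>|M. f (X \<omega>)) = (LINT z|lborel. std_normal_density z *\<^sub>R f z)"
    and "integrable M (\<lambda>\<omega>. f (X \<omega>)) \<longleftrightarrow> integrable lborel (\<lambda>z. std_normal_density z *\<^sub>R f z)"
proof -
  have "(LINT \<omega>|M. f (X \<omega>)) = (LINT x|distr M borel X. f x)"
    using X(1) by (simp add: integral_distr)
  then show "(LINT \<omega>|M. f (X \<omega>)) = (LINT z|lborel. std_normal_density z *\<^sub>R f z)"
    by (simp add: X(2) integral_density)
  have "integrable M (\<lambda>\<omega>. f (X \<omega>)) \<longleftrightarrow> integrable (distr M borel X) f"
    using X(1) by (simp add: integrable_distr_eq)
  then show "integrable M (\<lambda>\<omega>. f (X \<omega>)) \<longleftrightarrow> integrable lborel (\<lambda>z. std_normal_density z *\<^sub>R f z)"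
    by (simp add: X(2) integrable_density)
qed

text \<open>The second moment is expressed by \<open>g\<close> alone; it will serve as a bound
  uniform over all points of the field.\<close>

lemma sq_integrable_L2_gauss:
  assumes X: "X \<in> borel_measurable M" "distr M borel X = std_normal_distribution"
    and g: "L2_gauss g"
  shows "sq_integrable M (\<lambda>\<omega>. g (X \<omega>))"
    and "expectation (\<lambda>\<omega>. (g (X \<omega>))\<^sup>2) = (LINT z|lborel. (g z)\<^sup>2 * std_normal_density z)"
proof -
  have [measurable]: "g \<in> borel_measurable borel" using g by (simp add: L2_gauss_def)
  note [measurable] = X(1)
  show "sq_integrable M (\<lambda>\<omega>. g (X \<omega>))"
    using g standard_normal_integral(2)[OF X, of "\<lambda>x. (g x)\<^sup>2"]
    by (simp add: sq_integrable_def L2_gauss_def mult.commute)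
  show "expectation (\<lambda>\<omega>. (g (X \<omega>))\<^sup>2) = (LINT z|lborel. (g z)\<^sup>2 * std_normal_density z)"
    using standard_normal_integral(1)[OF X, of "\<lambda>x. (g x)\<^sup>2"] by (simp add: mult.commute)
qed

text \<open>Joint normality is expressed through linear combinations, not through a density, so that
  \<rho> = 1 and \<rho> = -1 are included.\<close>

definition standard_gaussian_pair :: "('a \<Rightarrow> real) \<Rightarrow> ('a \<Rightarrow> real) \<Rightarrow> real \<Rightarrow> bool" where
  "standard_gaussian_pair X Y \<rho> \<longleftrightarrow>
     (\<forall>a b. gaussian_rv M (\<lambda>\<omega>. a * X \<omega> + b * Y \<omega>)) \<and>
     expectation X = 0 \<and> expectation Y = 0 \<and>
     expectation (\<lambda>\<omega>. (X \<omega>)\<^sup>2) = 1 \<and> expectation (\<lambda>\<omega>. (Y \<omega>)\<^sup>2) = 1 \<and>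
     expectation (\<lambda>\<omega>. X \<omega> * Y \<omega>) = \<rho>"

lemma standard_gaussian_pair_marginal:
  assumes "standard_gaussian_pair X Y \<rho>"
  shows "X \<in> borel_measurable M" "Y \<in> borel_measurable M"
    "distr M borel X = std_normal_distribution" "distr M borel Y = std_normal_distribution"
    "sq_integrable M X" "sq_integrable M Y"
proof -
  have "gaussian_rv M (\<lambda>\<omega>. 1 * X \<omega> + 0 * Y \<omega>)" "gaussian_rv M (\<lambda>\<omega>. 0 * X \<omega> + 1 * Y \<omega>)"
    using assms unfolding standard_gaussian_pair_def by blast+
  then have g: "gaussian_rv M X" "gaussian_rv M Y" by simp_all
  then show m: "X \<in> borel_measurable M" "Y \<in> borel_measurable M"
    by (simp_all add: gaussian_rv_def)
  show d: "distr M borel X = std_normal_distribution" "distr M borel Y = std_normal_distribution"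
    using assms g unfolding standard_gaussian_pair_def by (auto intro: gaussian_rv_standard)
  show "sq_integrable M X" "sq_integrable M Y"
    using sq_integrable_L2_gauss(1)[OF m(1) d(1) L2_gauss_poly[of "[:0, 1:]"]]
      sq_integrable_L2_gauss(1)[OF m(2) d(2) L2_gauss_poly[of "[:0, 1:]"]] by simp_all
qed

lemma standard_gaussian_pair_char:
  assumes P: "standard_gaussian_pair X Y \<rho>"
  shows "(CLINT \<omega>|M. iexp (a * X \<omega> + b * Y \<omega>)) = of_real (exp (- (a\<^sup>2 + 2 * a * b * \<rho> + b\<^sup>2) / 2))"
proof -
  note s = standard_gaussian_pair_marginal(5,6)[OF P]
  note i = integrable_mult_sq_integrable[OF s] sq_integrable_square[OF s(1)] sq_integrable_square[OF s(2)]
    sq_integrable_imp_integrable[OF s(1)] sq_integrable_imp_integrable[OF s(2)]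
  note P' = P[unfolded standard_gaussian_pair_def]
  have "expectation (\<lambda>\<omega>. (a * X \<omega> + b * Y \<omega>)\<^sup>2) =
      expectation (\<lambda>\<omega>. a\<^sup>2 * (X \<omega>)\<^sup>2 + 2 * a * b * (X \<omega> * Y \<omega>) + b\<^sup>2 * (Y \<omega>)\<^sup>2)"
    by (simp add: power2_sum power_mult_distrib algebra_simps)
  also have "\<dots> = a\<^sup>2 + 2 * a * b * \<rho> + b\<^sup>2"
    using i P' by simp
  finally have var: "expectation (\<lambda>\<omega>. (a * X \<omega> + b * Y \<omega>)\<^sup>2) = a\<^sup>2 + 2 * a * b * \<rho> + b\<^sup>2" .
  have "expectation (\<lambda>\<omega>. a * X \<omega> + b * Y \<omega>) = 0"
    using i P' by simp
  with P' var show ?thesis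
    by (subst gaussian_rv_char) auto
qed

text \<open>Write \<open>X = \<rho> Y + W\<close>.  Then \<open>W\<close> and \<open>Y\<close> are uncorrelated and jointly Gaussian, so
  conditionally on \<open>Y\<close> the characteristic function of \<open>W\<close> is \<open>exp (- s\<^sup>2 (1 - \<rho>\<^sup>2) / 2)\<close>.\<close>

lemma standard_gaussian_pair_conditional_char:
  fixes g :: "real \<Rightarrow> complex"
  assumes P: "standard_gaussian_pair X Y \<rho>"
    and g[measurable]: "g \<in> borel_measurable borel" and int: "integrable M (\<lambda>\<omega>. g (Y \<omega>))"
  shows "(CLINT \<omega>|M. g (Y \<omega>) * iexp (s * X \<omega>)) =
    of_real (exp (- s\<^sup>2 * (1 - \<rho>\<^sup>2) / 2)) * (CLINT \<omega>|M. g (Y \<omega>) * iexp (s * \<rho> * Y \<omega>))"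
proof -
  note [measurable] = standard_gaussian_pair_marginal(1,2)[OF P]
  \<comment> \<open>The frequency \<open>s\<close> is absorbed here: this is \<open>s\<close> times
    the residual of \<open>X\<close> after regression on \<open>Y\<close>, and \<open>h\<close>
    below takes up the remaining factor \<open>exp (i s \<rho> Y)\<close>.\<close>
  define W where "W \<omega> = s * X \<omega> - s * \<rho> * Y \<omega>" for \<omega>
  have [measurable]: "W \<in> borel_measurable M" by (simp add: W_def[abs_def])
  define c where "c = exp (- s\<^sup>2 * (1 - \<rho>\<^sup>2) / 2)"
  define h where "h y = g y * iexp (s * \<rho> * y)" for y
  have [measurable]: "h \<in> borel_measurable borel" by (simp add: h_def[abs_def])
  have inth: "integrable M (\<lambda>\<omega>. h (Y \<omega>))"
    unfolding h_def by (rule Bochner_Integration.integrable_bound[OF int]) (auto simp: norm_mult)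
  have ch: "(CLINT \<omega>|M. iexp (r * Y \<omega> + W \<omega>)) = c * exp (- r\<^sup>2 / 2)"
    "(CLINT \<omega>|M. iexp (r * Y \<omega> - W \<omega>)) = c * exp (- r\<^sup>2 / 2)" for r
  proof -
    have "(CLINT \<omega>|M. iexp (r * Y \<omega> + W \<omega>)) = (CLINT \<omega>|M. iexp (s * X \<omega> + (r - s * \<rho>) * Y \<omega>))"
      by (simp add: W_def algebra_simps)
    also have "\<dots> = c * exp (- r\<^sup>2 / 2)"
      unfolding standard_gaussian_pair_char[OF P] c_def of_real_mult[symmetric] exp_add[symmetric]
      by (simp add: field_simps power2_eq_square)
    finally show "(CLINT \<omega>|M. iexp (r * Y \<omega> + W \<omega>)) = c * exp (- r\<^sup>2 / 2)" .
    have "(CLINT \<omega>|M. iexp (r * Y \<omega> - W \<omega>)) = (CLINT \<omega>|M. iexp ((- s) * X \<omega> + (r + s * \<rho>) * Y \<omega>))"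
      by (simp add: W_def algebra_simps)
    also have "\<dots> = c * exp (- r\<^sup>2 / 2)"
      unfolding standard_gaussian_pair_char[OF P] c_def of_real_mult[symmetric] exp_add[symmetric]
      by (simp add: field_simps power2_eq_square)
    finally show "(CLINT \<omega>|M. iexp (r * Y \<omega> - W \<omega>)) = c * exp (- r\<^sup>2 / 2)" .
  qed
  have ch0: "(CLINT \<omega>|M. iexp (r * Y \<omega>)) = exp (- r\<^sup>2 / 2)" for r
    using standard_gaussian_pair_char[OF P, of 0 r] by simp
  have int_iexp: "integrable M (\<lambda>\<omega>. iexp (f \<omega>))" if [measurable]: "f \<in> borel_measurable M" for f
    by (rule integrable_const_bound[of _ 1]) auto
  \<comment> \<open>The uniqueness lemma takes a real weight, so \<open>exp (i W)\<close> is split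
    into cosine and sine, each a combination of the exponentials of \<open>i W\<close> and
    \<open>- i W\<close>. These have the same transform by \<open>ch\<close>: the cosine acts like
    the constant \<open>c\<close>, and the sine cancels.\<close>
  have cos_eq: "cos x *\<^sub>R iexp y = (iexp (y + x) + iexp (y - x)) / 2"
    and sin_eq: "sin x *\<^sub>R iexp y = (iexp (y + x) - iexp (y - x)) / (2 * \<i>)" for x y
    by (simp_all add: exp_add exp_diff scaleR_conv_of_real cos_of_real[symmetric] sin_of_real[symmetric]
        cos_exp_eq sin_exp_eq exp_minus field_simps)
  have intc: "integrable M (\<lambda>\<omega>. cos (W \<omega>) - c)" and ints: "integrable M (\<lambda>\<omega>. sin (W \<omega>))"
    by (intro Bochner_Integration.integrable_diff integrable_const, auto intro!: integrable_const_bound[of _ 1])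
  have intc': "integrable M (\<lambda>\<omega>. cos (W \<omega>) *\<^sub>R f \<omega>)" and ints': "integrable M (\<lambda>\<omega>. sin (W \<omega>) *\<^sub>R f \<omega>)"
    if f: "integrable M f" for f :: "'a \<Rightarrow> complex"
    using borel_measurable_integrable[OF f]
    by (auto intro!: Bochner_Integration.integrable_bound[OF f] AE_I2 mult_left_le_one_le)
  have "(LINT \<omega>|M. (cos (W \<omega>) - c) *\<^sub>R h (Y \<omega>)) = 0"
  proof (rule integral_eq_0_if_char_eq_0[OF intc])
    show "(LINT \<omega>|M. (cos (W \<omega>) - c) *\<^sub>R iexp (r * Y \<omega>)) = 0" for r
      using int_iexp[of "\<lambda>\<omega>. r * Y \<omega> + W \<omega>"] int_iexp[of "\<lambda>\<omega>. r * Y \<omega> - W \<omega>"] int_iexp[of "\<lambda>\<omega>. r * Y \<omega>"]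
      unfolding scaleR_left_diff_distrib cos_eq
      by (subst Bochner_Integration.integral_diff) (simp_all add: ch[simplified] ch0[simplified] scaleR_conv_of_real)
    show "integrable M (\<lambda>\<omega>. (cos (W \<omega>) - c) *\<^sub>R h (Y \<omega>))"
      unfolding scaleR_left_diff_distrib using intc'[OF inth] inth by auto
  qed auto
  moreover have "(LINT \<omega>|M. (cos (W \<omega>) - c) *\<^sub>R h (Y \<omega>)) =
      (LINT \<omega>|M. cos (W \<omega>) *\<^sub>R h (Y \<omega>)) - c *\<^sub>R (LINT \<omega>|M. h (Y \<omega>))"
    using intc'[OF inth] inth by (simp add: scaleR_left_diff_distrib)
  ultimately have 1: "(LINT \<omega>|M. cos (W \<omega>) *\<^sub>R h (Y \<omega>)) = c * (LINT \<omega>|M. h (Y \<omega>))"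
    by (simp add: scaleR_conv_of_real)
  have 2: "(LINT \<omega>|M. sin (W \<omega>) *\<^sub>R h (Y \<omega>)) = 0"
  proof (rule integral_eq_0_if_char_eq_0[OF ints])
    show "(LINT \<omega>|M. sin (W \<omega>) *\<^sub>R iexp (r * Y \<omega>)) = 0" for r
      using int_iexp[of "\<lambda>\<omega>. r * Y \<omega> + W \<omega>"] int_iexp[of "\<lambda>\<omega>. r * Y \<omega> - W \<omega>"]
      unfolding sin_eq by (simp add: ch[simplified])
    show "integrable M (\<lambda>\<omega>. sin (W \<omega>) *\<^sub>R h (Y \<omega>))"
      using ints'[OF inth] .
  qed auto
  have "(CLINT \<omega>|M. g (Y \<omega>) * iexp (s * X \<omega>)) =
      (LINT \<omega>|M. cos (W \<omega>) *\<^sub>R h (Y \<omega>) + \<i> * (sin (W \<omega>) *\<^sub>R h (Y \<omega>)))"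
  proof (rule Bochner_Integration.integral_cong[OF refl])
    fix \<omega>
    have "iexp (s * X \<omega>) = iexp (s * \<rho> * Y \<omega>) * iexp (W \<omega>)"
      by (simp add: W_def algebra_simps flip: exp_add)
    also have "iexp (W \<omega>) = of_real (cos (W \<omega>)) + \<i> * of_real (sin (W \<omega>))"
      by (simp add: exp_Euler cos_of_real sin_of_real)
    finally show "g (Y \<omega>) * iexp (s * X \<omega>) = cos (W \<omega>) *\<^sub>R h (Y \<omega>) + \<i> * (sin (W \<omega>) *\<^sub>R h (Y \<omega>))"
      by (simp add: h_def scaleR_conv_of_real algebra_simps)
  qed
  also have "\<dots> = c * (LINT \<omega>|M. h (Y \<omega>))"
    using intc'[OF inth] ints'[OF inth] 1 2 by (simp del: mult_scaleR_right)
  finally show ?thesis by (simp add: c_def h_def)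
qed

text \<open>The coincident pair makes the formulas for pairs available for \<open>X\<close> alone,
  with correlation 1.\<close>

lemma standard_gaussian_pair_refl:
  assumes "standard_gaussian_pair X Y \<rho>"
  shows "standard_gaussian_pair X X 1"
proof -
  have "gaussian_rv M (\<lambda>\<omega>. a * X \<omega> + b * X \<omega>)" for a b
  proof -
    have "gaussian_rv M (\<lambda>\<omega>. (a + b) * X \<omega> + 0 * Y \<omega>)"
      using assms unfolding standard_gaussian_pair_def by blast
    then show ?thesis by (simp add: distrib_right)
  qed
  then show ?thesis
    using assms by (simp add: standard_gaussian_pair_def power2_eq_square)
qed

text \<open>Conditioning on \<open>Y\<close> moves the frequency from \<open>s\<close> to
  \<open>s \<rho>\<close>, where the Hermite transform is known. The factors
  \<open>exp (- s\<^sup>2 (1 - \<rho>\<^sup>2) / 2)\<close> and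
  \<open>exp (- (s \<rho>)\<^sup>2 / 2)\<close> multiply to \<open>exp (- s\<^sup>2 / 2)\<close>, so
  \<rho> survives only in the power.\<close>

lemma standard_gaussian_pair_hermite_char:
  assumes P: "standard_gaussian_pair X Y \<rho>"
  shows "(CLINT \<omega>|M. of_real (hermite n (Y \<omega>)) * iexp (s * X \<omega>)) =
    (\<i> * s * \<rho>) ^ n * of_real (exp (- s\<^sup>2 / 2))"
proof -
  note Y = standard_gaussian_pair_marginal(2,4)[OF P]
  note [measurable] = Y(1)
  have hm: "hermite n \<in> borel_measurable borel"
    by (simp add: hermite_eq_poly borel_measurable_continuous_onI continuous_on_poly)
  then have hmc[measurable]: "(\<lambda>z. complex_of_real (hermite n z)) \<in> borel_measurable borel"
    by simp
  have "integrable M (\<lambda>\<omega>. complex_of_real (hermite n (Y \<omega>)))"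
    using integrable_poly_std_normal[of "hermite_poly n"] hm
    by (simp add: standard_normal_integral(2)[OF Y] hermite_eq_poly mult.commute)
  note * = standard_gaussian_pair_conditional_char[OF P hmc this, of s]
  have "(CLINT \<omega>|M. of_real (hermite n (Y \<omega>)) * iexp (s * \<rho> * Y \<omega>)) = gauss_fourier (hermite_poly n) (s * \<rho>)"
    unfolding gauss_fourier_def using standard_normal_integral(1)[OF Y, of "\<lambda>z. of_real (hermite n z) * iexp (s * \<rho> * z)"]
    by (simp add: hermite_eq_poly scaleR_conv_of_real mult_ac)
  moreover have "complex_of_real (exp (- s\<^sup>2 * (1 - \<rho>\<^sup>2) / 2)) * of_real (exp (- (s * \<rho>)\<^sup>2 / 2)) = of_real (exp (- s\<^sup>2 / 2))"
    unfolding of_real_mult[symmetric] exp_add[symmetric]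
    by (simp add: field_simps power2_eq_square)
  ultimately show ?thesis
    unfolding * gauss_fourier_hermite_poly by (simp add: algebra_simps)
qed

text \<open>In conditional terms, the mean of \<open>H\<^sub>n(Y)\<close> given \<open>X\<close> is
  \<open>\<rho>\<^sup>n H\<^sub>n(X)\<close>. The difference \<open>U\<close> of the two integrates
  to 0 against every \<open>exp (i s X)\<close>, because
  \<open>(i s \<rho>)\<^sup>n = \<rho>\<^sup>n (i s)\<^sup>n\<close>, and hence against
  \<open>h(X)\<close>.\<close>

lemma standard_gaussian_pair_hermite:
  assumes P: "standard_gaussian_pair X Y \<rho>" and h: "L2_gauss h"
  shows "expectation (\<lambda>\<omega>. h (X \<omega>) * hermite n (Y \<omega>)) = \<rho> ^ n * hermite_coeff h n"
proof -
  note m = standard_gaussian_pair_marginal[OF P]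
  note [measurable] = m(1,2)
  have hm[measurable]: "hermite n \<in> borel_measurable borel"
    by (simp add: hermite_eq_poly borel_measurable_continuous_onI continuous_on_poly)
  have [measurable]: "h \<in> borel_measurable borel" using h by (simp add: L2_gauss_def)
  have sX: "sq_integrable M (\<lambda>\<omega>. hermite n (X \<omega>))" and sY: "sq_integrable M (\<lambda>\<omega>. hermite n (Y \<omega>))"
    and sh: "sq_integrable M (\<lambda>\<omega>. h (X \<omega>))"
    by (intro sq_integrable_L2_gauss(1)[OF m(1,3)] sq_integrable_L2_gauss(1)[OF m(2,4)] L2_gauss_hermite h)+
  define U where "U \<omega> = hermite n (Y \<omega>) - \<rho> ^ n * hermite n (X \<omega>)" for \<omega>
  have sU: "sq_integrable M U"
    unfolding U_def by (intro sq_integrable_diff sq_integrable_cmult sX sY)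
  have "(LINT \<omega>|M. U \<omega> *\<^sub>R h (X \<omega>)) = 0"
  proof (rule integral_eq_0_if_char_eq_0[where U = U and X = X and g = h])
    show "integrable M U" by (rule sq_integrable_imp_integrable[OF sU])
    show "integrable M (\<lambda>\<omega>. U \<omega> *\<^sub>R h (X \<omega>))"
      using integrable_mult_sq_integrable[OF sU sh] by simp
    show "(LINT \<omega>|M. U \<omega> *\<^sub>R iexp (s * X \<omega>)) = 0" for s
    proof -
      have i: "integrable M (\<lambda>\<omega>. complex_of_real (f \<omega>) * iexp (s * X \<omega>))" if "sq_integrable M f" for f
        using sq_integrable_measurable[OF that]
        by (intro Bochner_Integration.integrable_bound[OF sq_integrable_imp_integrable[OF that]])
          (auto simp: norm_mult)
      have "(LINT \<omega>|M. U \<omega> *\<^sub>R iexp (s * X \<omega>)) =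
         (LINT \<omega>|M. of_real (hermite n (Y \<omega>)) * iexp (s * X \<omega>)
           - of_real (\<rho> ^ n) * (of_real (hermite n (X \<omega>)) * iexp (s * X \<omega>)))"
        by (simp add: U_def scaleR_conv_of_real algebra_simps)
      also have "\<dots> = (\<i> * s * \<rho>) ^ n * of_real (exp (- s\<^sup>2 / 2))
          - of_real (\<rho> ^ n) * ((\<i> * s * 1) ^ n * of_real (exp (- s\<^sup>2 / 2)))"
        using i[OF sX] i[OF sY] standard_gaussian_pair_hermite_char[OF P, of n s]
          standard_gaussian_pair_hermite_char[OF standard_gaussian_pair_refl[OF P], of n s]
        by simp
      also have "\<dots> = 0" by (simp add: power_mult_distrib)
      finally show ?thesis .
    qed
  qed auto
  then have "expectation (\<lambda>\<omega>. h (X \<omega>) * hermite n (Y \<omega>)) = \<rho> ^ n * expectation (\<lambda>\<omega>. h (X \<omega>) * hermite n (X \<omega>))"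
    using integrable_mult_sq_integrable[OF sh sX] integrable_mult_sq_integrable[OF sh sY]
    by (simp add: U_def algebra_simps)
  also have "expectation (\<lambda>\<omega>. h (X \<omega>) * hermite n (X \<omega>)) = hermite_coeff h n"
    using standard_normal_integral(1)[OF m(1,3), of "\<lambda>z. h z * hermite n z"]
    by (simp add: hermite_coeff_def mult_ac)
  finally show ?thesis .
qed

end

subsection \<open>Lipschitz approximation in \<open>L\<^sub>2\<close>\<close>

text \<open>Composition with a Lipschitz function increases an \<open>L\<^sub>2\<close> distance by
  at most the factor \<open>L\<close>. The class is closed under sums, multiples and clamping, which
  the density proof uses.\<close>

definition Lipschitz_real :: "(real \<Rightarrow> real) \<Rightarrow> bool" where
  "Lipschitz_real h \<longleftrightarrow> (\<exists>L\<ge>0. \<forall>x y. \<bar>h x - h y\<bar> \<le> L * \<bar>x - y\<bar>)"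

lemma Lipschitz_real_add:
  assumes "Lipschitz_real f" "Lipschitz_real g"
  shows "Lipschitz_real (\<lambda>x. f x + g x)"
proof -
  obtain L L' where "L \<ge> 0" "L' \<ge> 0" and *: "\<And>x y. \<bar>f x - f y\<bar> \<le> L * \<bar>x - y\<bar>" "\<And>x y. \<bar>g x - g y\<bar> \<le> L' * \<bar>x - y\<bar>"
    using assms by (auto simp: Lipschitz_real_def)
  have "\<bar>(f x + g x) - (f y + g y)\<bar> \<le> (L + L') * \<bar>x - y\<bar>" for x y
    using *(1)[of x y] *(2)[of x y] by (simp add: distrib_right)
  with \<open>L \<ge> 0\<close> \<open>L' \<ge> 0\<close> show ?thesis
    unfolding Lipschitz_real_def by (intro exI[of _ "L + L'"]) auto
qed

lemma Lipschitz_real_cmult: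
  assumes "Lipschitz_real f"
  shows "Lipschitz_real (\<lambda>x. c * f x)"
proof -
  obtain L where "L \<ge> 0" and *: "\<And>x y. \<bar>f x - f y\<bar> \<le> L * \<bar>x - y\<bar>"
    using assms by (auto simp: Lipschitz_real_def)
  have "\<bar>c * f x - c * f y\<bar> \<le> (\<bar>c\<bar> * L) * \<bar>x - y\<bar>" for x y
    using mult_left_mono[OF *[of x y], of "\<bar>c\<bar>"] by (simp add: abs_mult mult.assoc flip: right_diff_distrib)
  with \<open>L \<ge> 0\<close> show ?thesis
    unfolding Lipschitz_real_def by (intro exI[of _ "\<bar>c\<bar> * L"]) auto
qed

lemma Lipschitz_real_clamp:
  assumes "Lipschitz_real f"
  shows "Lipschitz_real (\<lambda>x. max a (min b (f x)))"
proof -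
  obtain L where "L \<ge> 0" and *: "\<And>x y. \<bar>f x - f y\<bar> \<le> L * \<bar>x - y\<bar>"
    using assms by (auto simp: Lipschitz_real_def)
  have "\<bar>max a (min b (f x)) - max a (min b (f y))\<bar> \<le> L * \<bar>x - y\<bar>" for x y
  proof -
    have "\<bar>max a (min b u) - max a (min b v)\<bar> \<le> \<bar>u - v\<bar>" for u v :: real
      by (auto simp: max_def min_def)
    from order_trans[OF this *[of x y]] show ?thesis .
  qed
  with \<open>L \<ge> 0\<close> show ?thesis
    unfolding Lipschitz_real_def by auto
qed

lemma Lipschitz_real_measurable:
  assumes "Lipschitz_real h"
  shows "h \<in> borel_measurable borel"
proof -
  obtain L where "L \<ge> 0" and *: "\<And>x y. \<bar>h x - h y\<bar> \<le> L * \<bar>x - y\<bar>"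
    using assms by (auto simp: Lipschitz_real_def)
  have "isCont h x" for x
    unfolding isCont_def
  proof (rule LIM_zero_cancel, rule Lim_null_comparison)
    show "\<forall>\<^sub>F y in at x. norm (h y - h x) \<le> L * \<bar>y - x\<bar>"
      using * \<open>L \<ge> 0\<close> by simp
  next
    show "((\<lambda>y. L * \<bar>y - x\<bar>) \<longlongrightarrow> 0) (at x)"
      by (auto intro!: tendsto_eq_intros)
  qed
  then show ?thesis
    by (intro borel_measurable_continuous_onI) (simp add: continuous_at_imp_continuous_on)
qed

text \<open>Inner regularity replaces \<open>A\<close> by a compact subset \<open>F\<close>, and the
  tent functions \<open>h n\<close> around \<open>F\<close> tend to its indicator because
  \<open>F\<close> is closed.\<close>

lemma Lipschitz_indicator_approximation:
  fixes N :: "real measure"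
  assumes N: "finite_measure N" and sets: "sets N = sets borel"
    and A: "A \<in> sets borel" and "\<epsilon> > 0"
  shows "\<exists>h. integrable N h \<and> Lipschitz_real h \<and> (LINT x|N. \<bar>indicator A x - h x\<bar>) < \<epsilon>"
proof -
  interpret finite_measure N by fact
  note [measurable_cong] = sets
  note [measurable] = A
  \<comment> \<open>Subtraction in \<open>ennreal\<close> is truncated at 0, so the strict
    inequality would fail for a null set; that case is split off and settled by the empty compact
    set.\<close>
  have "ennreal (measure N A) - ennreal (\<epsilon> / 2) < (SUP K\<in>{K. K \<subseteq> A \<and> compact K}. emeasure N K)
      \<or> measure N A = 0"
  proof (cases "measure N A = 0")
    case False
    have "(SUP K\<in>{K. K \<subseteq> A \<and> compact K}. emeasure N K) = ennreal (measure N A)"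
      using inner_regular[OF sets _ A] emeasure_eq_measure by simp
    moreover have "ennreal (measure N A) - ennreal (\<epsilon> / 2) < ennreal (measure N A)"
      using False \<open>\<epsilon> > 0\<close> zero_less_measure_iff[of N A]
      by (simp add: ennreal_minus ennreal_lessI)
    ultimately show ?thesis by simp
  qed simp
  then have "\<exists>F. F \<subseteq> A \<and> compact F \<and> measure N A < measure N F + \<epsilon> / 2"
  proof
    assume "ennreal (measure N A) - ennreal (\<epsilon> / 2) < (SUP K\<in>{K. K \<subseteq> A \<and> compact K}. emeasure N K)"
    then obtain F where F: "F \<subseteq> A" "compact F" "ennreal (measure N A) - ennreal (\<epsilon> / 2) < emeasure N F"
      by (auto simp: less_SUP_iff)
    then have "ennreal (measure N A - \<epsilon> / 2) < ennreal (measure N F)"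
      using \<open>\<epsilon> > 0\<close> by (simp add: emeasure_eq_measure ennreal_minus)
    then have "measure N A - \<epsilon> / 2 < measure N F"
      by (meson ennreal_leI not_le)
    with F show ?thesis by (intro exI[of _ F]) auto
  next
    assume "measure N A = 0"
    with \<open>\<epsilon> > 0\<close> show ?thesis by (intro exI[of _ "{}"]) auto
  qed
  then obtain F where F: "F \<subseteq> A" "compact F" "measure N A < measure N F + \<epsilon> / 2"
    by blast
  have [measurable]: "F \<in> sets borel" using F by (simp add: borel_compact)
  have iAF: "(LINT x|N. \<bar>indicator A x - indicator F x :: real\<bar>) < \<epsilon> / 2"
  proof -
    have "(LINT x|N. \<bar>indicator A x - indicator F x :: real\<bar>) = (LINT x|N. indicator A x - indicator F x)"
      using F(1) by (intro Bochner_Integration.integral_cong) (auto simp: indicator_def)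
    also have "\<dots> = measure N A - measure N F"
      by (subst Bochner_Integration.integral_diff) (auto simp: sets_eq_imp_space_eq[OF sets] less_top[symmetric])
    finally show ?thesis using F by simp
  qed
  show ?thesis
  \<comment> \<open>By convention \<open>infdist x {} = 0\<close>, so tents over the empty set would
    be constantly 1; the zero function is taken instead.\<close>
  proof (cases "F = {}")
    case True
    with iAF \<open>\<epsilon> > 0\<close> show ?thesis
      by (intro exI[of _ "\<lambda>_. 0"]) (auto simp: Lipschitz_real_def)
  next
    case False
    define h where "h n x = max 0 (min 1 (1 - real n * infdist x F))" for n x
    have Lip: "Lipschitz_real (h n)" for n
    proof -
      have "Lipschitz_real (\<lambda>x. 1 + - real n * infdist x F)"
        by (intro Lipschitz_real_add Lipschitz_real_cmult)
          (use infdist_triangle_abs[of _ F] in \<open>auto simp: Lipschitz_real_def dist_real_def intro!: exI[of _ 1]\<close>)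
      from Lipschitz_real_clamp[OF this, of 0 1] show ?thesis
        by (simp add: h_def[abs_def])
    qed
    note [measurable] = Lipschitz_real_measurable[OF Lip]
    have bnd: "\<bar>h n x\<bar> \<le> 1" for n x
      by (simp add: h_def)
    have inth: "integrable N (h n)" for n
      by (rule integrable_const_bound[of _ 1]) (use bnd in auto)
    have "(\<lambda>n. LINT x|N. \<bar>indicator F x - h n x\<bar>) \<longlonglongrightarrow> (LINT x|N. 0)"
    proof (rule integral_dominated_convergence[where w="\<lambda>_. 2"])
      show "AE x in N. (\<lambda>n. \<bar>indicator F x - h n x\<bar>) \<longlonglongrightarrow> 0"
      proof (rule AE_I2)
        fix x
        show "(\<lambda>n. \<bar>indicator F x - h n x\<bar>) \<longlonglongrightarrow> 0"
        proof (cases "x \<in> F")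
          case False
          then have pos: "infdist x F > 0"
            using F \<open>F \<noteq> {}\<close> by (simp add: infdist_pos_not_in_closed compact_imp_closed)
          obtain n0 :: nat where n0: "1 / infdist x F < real n0"
            using reals_Archimedean2 by blast
          have "h n x = 0" if "n \<ge> n0" for n
          proof -
            have "1 < real n0 * infdist x F" using n0 pos by (simp add: field_simps)
            also have "\<dots> \<le> real n * infdist x F" using that pos by (intro mult_right_mono) auto
            finally show ?thesis by (simp add: h_def)
          qed
          then have "\<forall>\<^sub>F n in sequentially. \<bar>indicator F x - h n x\<bar> = 0"
            using False by (auto simp: eventually_sequentially)
          then show ?thesis by (rule tendsto_eventually)
        qed (simp add: h_def)
      qed
      show "AE x in N. norm \<bar>indicator F x - h n x\<bar> \<le> 2" for n
        by (rule AE_I2) (auto simp: h_def indicator_def)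
    qed auto
    then have "\<forall>\<^sub>F n in sequentially. (LINT x|N. \<bar>indicator F x - h n x\<bar>) < \<epsilon> / 2"
      using \<open>\<epsilon> > 0\<close> by (intro order_tendstoD(2)) auto
    then obtain n where n: "(LINT x|N. \<bar>indicator F x - h n x\<bar>) < \<epsilon> / 2"
      by (auto simp: eventually_sequentially)
    have ind: "integrable N (indicator A :: real \<Rightarrow> real)" "integrable N (indicator F :: real \<Rightarrow> real)"
      by (auto intro!: integrable_const_bound[of _ 1])
    have "(LINT x|N. \<bar>indicator A x - h n x\<bar>) \<le>
        (LINT x|N. \<bar>indicator A x - indicator F x\<bar> + \<bar>indicator F x - h n x\<bar>)"
      using ind inth by (intro integral_mono) auto
    also have "\<dots> = (LINT x|N. \<bar>indicator A x - indicator F x\<bar>) + (LINT x|N. \<bar>indicator F x - h n x\<bar>)"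
      using ind inth by (intro Bochner_Integration.integral_add) auto
    also have "\<dots> < \<epsilon>" using iAF n by simp
    finally show ?thesis using Lip inth by blast
  qed
qed

text \<open>The quantifier over \<epsilon> belongs to the induction claim, so that summands and
  limits can call on the hypothesis with half the tolerance.\<close>

lemma Lipschitz_dense_L1:
  fixes N :: "real measure" and f :: "real \<Rightarrow> real"
  assumes N: "finite_measure N" and sets: "sets N = sets borel" and f: "integrable N f"
  shows "\<forall>\<epsilon>>0. \<exists>h. integrable N h \<and> Lipschitz_real h \<and> (LINT x|N. \<bar>f x - h x\<bar>) < \<epsilon>"
  using f
proof (induction rule: integrable_induct)
  case (base A c)
  show ?case
  proof (intro allI impI)
    fix \<epsilon> :: real assume "\<epsilon> > 0"
    \<comment> \<open>The added 1 keeps the tolerance meaningful for \<open>c = 0\<close>.\<close>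
    then obtain h where h: "integrable N h" "Lipschitz_real h" "(LINT x|N. \<bar>indicator A x - h x\<bar>) < \<epsilon> / (\<bar>c\<bar> + 1)"
      using Lipschitz_indicator_approximation[OF N sets, of A "\<epsilon> / (\<bar>c\<bar> + 1)"] base sets by auto
    have "(LINT x|N. \<bar>indicator A x *\<^sub>R c - c * h x\<bar>) = (LINT x|N. \<bar>c\<bar> * \<bar>indicator A x - h x\<bar>)"
      by (simp add: mult.commute[of _ c] flip: abs_mult right_diff_distrib)
    also have "\<dots> = \<bar>c\<bar> * (LINT x|N. \<bar>indicator A x - h x\<bar>)" by simp
    also have "\<dots> \<le> (\<bar>c\<bar> + 1) * (LINT x|N. \<bar>indicator A x - h x\<bar>)"
      by (intro mult_right_mono) auto
    also have "\<dots> < \<epsilon>"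
      using h(3) by (simp add: field_simps)
    finally show "\<exists>h. integrable N h \<and> Lipschitz_real h \<and> (LINT x|N. \<bar>indicator A x *\<^sub>R c - h x\<bar>) < \<epsilon>"
      using h(1,2) by (intro exI[of _ "\<lambda>x. c * h x"]) (auto intro: Lipschitz_real_cmult)
  qed
next
  case (add f g)
  show ?case
  proof (intro allI impI)
    fix \<epsilon> :: real assume "\<epsilon> > 0"
    obtain h1 where h1: "integrable N h1" "Lipschitz_real h1" "(LINT x|N. \<bar>f x - h1 x\<bar>) < \<epsilon> / 2"
      using add.IH(1) \<open>\<epsilon> > 0\<close> half_gt_zero by blast
    obtain h2 where h2: "integrable N h2" "Lipschitz_real h2" "(LINT x|N. \<bar>g x - h2 x\<bar>) < \<epsilon> / 2"
      using add.IH(2) \<open>\<epsilon> > 0\<close> half_gt_zero by blast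
    have "(LINT x|N. \<bar>(f x + g x) - (h1 x + h2 x)\<bar>) \<le> (LINT x|N. \<bar>f x - h1 x\<bar> + \<bar>g x - h2 x\<bar>)"
      using h1 h2 add.hyps by (intro integral_mono) auto
    also have "\<dots> < \<epsilon>"
      using h1 h2 add.hyps by simp
    finally show "\<exists>h. integrable N h \<and> Lipschitz_real h \<and> (LINT x|N. \<bar>f x + g x - h x\<bar>) < \<epsilon>"
      using h1 h2 by (intro exI[of _ "\<lambda>x. h1 x + h2 x"]) (auto intro: Lipschitz_real_add)
  qed
next
  case (lim f s)
  show ?case
  proof (intro allI impI)
    fix \<epsilon> :: real assume "\<epsilon> > 0"
    have "(\<lambda>i. LINT x|N. \<bar>f x - s i x\<bar>) \<longlonglongrightarrow> (LINT x|N. 0)"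
    \<comment> \<open>The simple functions of the induction rule are bounded by twice
      \<open>norm (f x)\<close>, so their distance from \<open>f\<close> is at most three times
      it.\<close>
    proof (rule integral_dominated_convergence[where w="\<lambda>x. 3 * norm (f x)"])
      show "AE x in N. (\<lambda>i. \<bar>f x - s i x\<bar>) \<longlonglongrightarrow> 0"
      proof (rule AE_I2)
        fix x assume "x \<in> space N"
        then have "(\<lambda>i. \<bar>f x - s i x\<bar>) \<longlonglongrightarrow> \<bar>f x - f x\<bar>"
          using lim.hyps(2) by (intro tendsto_intros) auto
        then show "(\<lambda>i. \<bar>f x - s i x\<bar>) \<longlonglongrightarrow> 0" by simp
      qed
      show "AE x in N. norm \<bar>f x - s i x\<bar> \<le> 3 * norm (f x)" for i
        using lim.hyps(3)[of _ i] by (intro AE_I2) (fastforce simp: abs_le_iff)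
    qed (use lim.hyps in auto)
    then have "\<forall>\<^sub>F i in sequentially. (LINT x|N. \<bar>f x - s i x\<bar>) < \<epsilon> / 2"
      using \<open>\<epsilon> > 0\<close> by (intro order_tendstoD(2)) auto
    then obtain i where i: "(LINT x|N. \<bar>f x - s i x\<bar>) < \<epsilon> / 2"
      by (auto simp: eventually_sequentially)
    obtain h where h: "integrable N h" "Lipschitz_real h" "(LINT x|N. \<bar>s i x - h x\<bar>) < \<epsilon> / 2"
      using lim.IH[of i] \<open>\<epsilon> > 0\<close> half_gt_zero by blast
    have "(LINT x|N. \<bar>f x - h x\<bar>) \<le> (LINT x|N. \<bar>f x - s i x\<bar> + \<bar>s i x - h x\<bar>)"
      using h lim.hyps by (intro integral_mono) auto
    also have "\<dots> < \<epsilon>"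
      using h i lim.hyps by simp
    finally show "\<exists>h. integrable N h \<and> Lipschitz_real h \<and> (LINT x|N. \<bar>f x - h x\<bar>) < \<epsilon>"
      using h by blast
  qed
qed

lemma sq_sum_le: "(a + b)\<^sup>2 \<le> 2 * a\<^sup>2 + 2 * b\<^sup>2" for a b :: real
  using sum_squares_bound[of a b] by (simp add: power2_sum)

text \<open>After truncating \<open>g\<close> at level \<open>n\<close> and clamping an
  \<open>L\<^sub>1\<close> approximant to the same range, the difference is at most
  \<open>2 n\<close>, so its square is at most \<open>2 n\<close> times the \<open>L\<^sub>1\<close>
  error.\<close>

lemma Lipschitz_dense_L2:
  fixes N :: "real measure"
  assumes N: "finite_measure N" and sets: "sets N = sets borel" and g: "sq_integrable N g" and "\<epsilon> > 0"
  shows "\<exists>h. sq_integrable N h \<and> Lipschitz_real h \<and> (LINT x|N. (g x - h x)\<^sup>2) < \<epsilon>"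
proof -
  interpret finite_measure N by fact
  note [measurable_cong] = sets
  note [measurable] = sq_integrable_measurable[OF g]
  define t where "t n x = max (- real n) (min (real n) (g x))" for n x
  have [measurable]: "t n \<in> borel_measurable N" for n
    unfolding t_def[abs_def] by measurable
  have t_bnd: "\<bar>t n x\<bar> \<le> real n" for n x by (auto simp: t_def)
  have sqt: "sq_integrable N (t n)" for n
    using t_bnd[of n] unfolding sq_integrable_def
    by (auto intro!: integrable_const_bound[of _ "(real n)\<^sup>2"] simp flip: abs_le_square_iff)
  have "(\<lambda>n. LINT x|N. (g x - t n x)\<^sup>2) \<longlonglongrightarrow> (LINT x|N. 0)"
  proof (rule integral_dominated_convergence[where w="\<lambda>x. (g x)\<^sup>2"])
    show "AE x in N. (\<lambda>n. (g x - t n x)\<^sup>2) \<longlonglongrightarrow> 0"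
    proof (rule AE_I2)
      fix x
      obtain n0 :: nat where "\<bar>g x\<bar> \<le> real n0" using real_arch_simple by blast
      then have "\<forall>\<^sub>F n in sequentially. (g x - t n x)\<^sup>2 = 0"
        by (auto simp: eventually_sequentially t_def intro!: exI[of _ n0])
      then show "(\<lambda>n. (g x - t n x)\<^sup>2) \<longlonglongrightarrow> 0" by (rule tendsto_eventually)
    qed
    show "AE x in N. norm ((g x - t n x)\<^sup>2) \<le> (g x)\<^sup>2" for n
    proof (rule AE_I2)
      fix x
      have "\<bar>g x - t n x\<bar> \<le> \<bar>g x\<bar>" by (auto simp: t_def max_def min_def)
      then show "norm ((g x - t n x)\<^sup>2) \<le> (g x)\<^sup>2" by (simp flip: abs_le_square_iff)
    qed
  qed (use g in \<open>auto simp: sq_integrable_def\<close>)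
  then have "\<forall>\<^sub>F n in sequentially. (LINT x|N. (g x - t n x)\<^sup>2) < \<epsilon> / 4"
    using \<open>\<epsilon> > 0\<close> by (intro order_tendstoD(2)) auto
  then obtain n where n: "(LINT x|N. (g x - t n x)\<^sup>2) < \<epsilon> / 4"
    by (auto simp: eventually_sequentially)
  \<comment> \<open>Chosen so that \<open>2 (n + 1) e = \<epsilon> / 4\<close>, with
    \<open>n + 1\<close> to allow \<open>n = 0\<close>. Two errors of \<epsilon>/4, doubled by
    \<open>sq_sum_le\<close>, add up to \<epsilon>.\<close>
  define e where "e = \<epsilon> / (8 * (real n + 1))"
  have "e > 0" using \<open>\<epsilon> > 0\<close> by (simp add: e_def)
  then obtain h1 where h1: "integrable N h1" "Lipschitz_real h1" "(LINT x|N. \<bar>t n x - h1 x\<bar>) < e"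
    using Lipschitz_dense_L1[OF N sets sq_integrable_imp_integrable[OF sqt[of n]]] by blast
  define h where "h x = max (- real n) (min (real n) (h1 x))" for x
  have Lip: "Lipschitz_real h"
    unfolding h_def[abs_def] by (rule Lipschitz_real_clamp[OF h1(2)])
  note [measurable] = Lipschitz_real_measurable[OF Lip]
  have h_bnd: "\<bar>h x\<bar> \<le> real n" for x by (auto simp: h_def)
  have sqh: "sq_integrable N h"
    using h_bnd unfolding sq_integrable_def
    by (auto intro!: integrable_const_bound[of _ "(real n)\<^sup>2"] simp flip: abs_le_square_iff)
  have "(LINT x|N. (t n x - h x)\<^sup>2) \<le> (LINT x|N. 2 * real n * \<bar>t n x - h1 x\<bar>)"
  proof (intro integral_mono)
    show "integrable N (\<lambda>x. (t n x - h x)\<^sup>2)"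
      by (rule sq_integrable_square[OF sq_integrable_diff[OF sqt sqh]])
    show "integrable N (\<lambda>x. 2 * real n * \<bar>t n x - h1 x\<bar>)"
      using h1(1) sq_integrable_imp_integrable[OF sqt[of n]] by auto
    fix x
    have "\<bar>t n x - h x\<bar> \<le> \<bar>t n x - h1 x\<bar>" using t_bnd[of n x] by (auto simp: h_def max_def min_def)
    moreover have "\<bar>t n x - h x\<bar> \<le> 2 * real n" using t_bnd[of n x] h_bnd[of x] by linarith
    ultimately have "\<bar>t n x - h x\<bar> * \<bar>t n x - h x\<bar> \<le> 2 * real n * \<bar>t n x - h1 x\<bar>"
      by (intro mult_mono) auto
    then show "(t n x - h x)\<^sup>2 \<le> 2 * real n * \<bar>t n x - h1 x\<bar>"
      by (simp add: power2_eq_square)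
  qed
  also have "\<dots> = 2 * real n * (LINT x|N. \<bar>t n x - h1 x\<bar>)" by simp
  also have "\<dots> \<le> 2 * (real n + 1) * e" using h1(3) \<open>e > 0\<close> by (intro mult_mono) auto
  also have "\<dots> = \<epsilon> / 4" by (simp add: e_def field_simps)
  finally have th: "(LINT x|N. (t n x - h x)\<^sup>2) \<le> \<epsilon> / 4" .
  have i: "integrable N (\<lambda>x. (g x - t n x)\<^sup>2)" "integrable N (\<lambda>x. (t n x - h x)\<^sup>2)" "integrable N (\<lambda>x. (g x - h x)\<^sup>2)"
    using sqt sqh g by (auto intro!: sq_integrable_square sq_integrable_diff)
  have "(LINT x|N. (g x - h x)\<^sup>2) \<le> (LINT x|N. 2 * (g x - t n x)\<^sup>2 + 2 * (t n x - h x)\<^sup>2)"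
  proof (intro integral_mono i)
    show "(g x - h x)\<^sup>2 \<le> 2 * (g x - t n x)\<^sup>2 + 2 * (t n x - h x)\<^sup>2" for x
      using sq_sum_le[of "g x - t n x" "t n x - h x"] by simp
  qed (use i in auto)
  also have "\<dots> < \<epsilon>" using i n th by simp
  finally show ?thesis using Lip sqh by blast
qed

context prob_space
begin

text \<open>For a Lipschitz approximant \<open>h\<close>, the errors \<open>g(X) - h(X)\<close> and
  \<open>g(Y) - h(Y)\<close> have the same \<open>L\<^sub>2\<close> norm, determined by the common
  law. Hence \<delta> depends only on \<open>g\<close> and \<epsilon>, not on the pair.\<close>

lemma standard_normal_uniform_L2_continuity:
  assumes g: "L2_gauss g" and "\<epsilon> > 0"
  shows "\<exists>\<delta>>0. \<forall>X Y. X \<in> borel_measurable M \<longrightarrow> Y \<in> borel_measurable M \<longrightarrow>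
    distr M borel X = std_normal_distribution \<longrightarrow> distr M borel Y = std_normal_distribution \<longrightarrow>
    expectation (\<lambda>\<omega>. (X \<omega> - Y \<omega>)\<^sup>2) < \<delta> \<longrightarrow> expectation (\<lambda>\<omega>. (g (X \<omega>) - g (Y \<omega>))\<^sup>2) < \<epsilon>"
proof -
  let ?N = "std_normal_distribution"
  interpret N: real_distribution ?N by (rule real_dist_normal_dist)
  have [measurable]: "g \<in> borel_measurable borel" using g by (simp add: L2_gauss_def)
  have "sq_integrable ?N g"
    using g by (simp add: sq_integrable_def L2_gauss_def integrable_density mult.commute)
  then obtain h where h: "sq_integrable ?N h" "Lipschitz_real h" "(LINT x|?N. (g x - h x)\<^sup>2) < \<epsilon> / 16"
    using Lipschitz_dense_L2[OF N.finite_measure_axioms _ _, of g "\<epsilon> / 16"] \<open>\<epsilon> > 0\<close> by auto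
  note [measurable] = Lipschitz_real_measurable[OF h(2)]
  obtain L where "L \<ge> 0" and L: "\<And>x y. \<bar>h x - h y\<bar> \<le> L * \<bar>x - y\<bar>"
    using h(2) by (auto simp: Lipschitz_real_def)
  \<comment> \<open>This makes \<open>2 (L\<^sup>2 + 1) \<delta> = \<epsilon> / 2\<close>; the two
    approximation errors, each below \<epsilon>/16 and weighted by 4, supply the other half.\<close>
  define \<delta> where "\<delta> = \<epsilon> / (4 * (L\<^sup>2 + 1))"
  have "L\<^sup>2 + 1 > 0" by (simp add: add_nonneg_pos)
  then have "\<delta> > 0" using \<open>\<epsilon> > 0\<close> by (simp add: \<delta>_def)
  show ?thesis
  proof (intro exI[of _ \<delta>] conjI allI impI \<open>\<delta> > 0\<close>)
    fix X Y assume m[measurable]: "X \<in> borel_measurable M" "Y \<in> borel_measurable M"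
      and d: "distr M borel X = ?N" "distr M borel Y = ?N"
      and lt: "expectation (\<lambda>\<omega>. (X \<omega> - Y \<omega>)\<^sup>2) < \<delta>"
    have L2h: "L2_gauss h"
      using h(1) by (simp add: sq_integrable_def L2_gauss_def integrable_density mult.commute)
    have sX: "sq_integrable M X" and sY: "sq_integrable M Y"
      using sq_integrable_L2_gauss(1)[OF m(1) d(1) L2_gauss_poly[of "[:0, 1:]"]]
        sq_integrable_L2_gauss(1)[OF m(2) d(2) L2_gauss_poly[of "[:0, 1:]"]] by simp_all
    note s = sq_integrable_L2_gauss(1)[OF m(1) d(1) g] sq_integrable_L2_gauss(1)[OF m(2) d(2) g]
      sq_integrable_L2_gauss(1)[OF m(1) d(1) L2h] sq_integrable_L2_gauss(1)[OF m(2) d(2) L2h]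
    note i = sq_integrable_square[OF sq_integrable_diff[OF s(1,3)]]
      sq_integrable_square[OF sq_integrable_diff[OF s(2,4)]]
      sq_integrable_square[OF sq_integrable_diff[OF s(1,2)]]
      sq_integrable_square[OF sq_integrable_diff[OF sX sY]]
    have gh: "expectation (\<lambda>\<omega>. (g (V \<omega>) - h (V \<omega>))\<^sup>2) < \<epsilon> / 16"
      if [measurable]: "V \<in> borel_measurable M" and V: "distr M borel V = ?N" for V
      using h(3) integral_distr[OF that(1), of "\<lambda>x. (g x - h x)\<^sup>2"] by (simp add: V)
    have "expectation (\<lambda>\<omega>. (g (X \<omega>) - g (Y \<omega>))\<^sup>2) \<le>
      expectation (\<lambda>\<omega>. 4 * (g (X \<omega>) - h (X \<omega>))\<^sup>2 + 4 * (g (Y \<omega>) - h (Y \<omega>))\<^sup>2 + 2 * L\<^sup>2 * (X \<omega> - Y \<omega>)\<^sup>2)"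
    proof (intro integral_mono i)
      fix \<omega>
      have "(h (X \<omega>) - h (Y \<omega>))\<^sup>2 \<le> (L * (X \<omega> - Y \<omega>))\<^sup>2"
        using L[of "X \<omega>" "Y \<omega>"] \<open>L \<ge> 0\<close> by (simp add: abs_mult flip: abs_le_square_iff)
      moreover have "(g (X \<omega>) - g (Y \<omega>))\<^sup>2 \<le>
          2 * ((g (X \<omega>) - h (X \<omega>)) + (h (Y \<omega>) - g (Y \<omega>)))\<^sup>2 + 2 * (h (X \<omega>) - h (Y \<omega>))\<^sup>2"
        using sq_sum_le[of "(g (X \<omega>) - h (X \<omega>)) + (h (Y \<omega>) - g (Y \<omega>))" "h (X \<omega>) - h (Y \<omega>)"] by simp
      moreover have "((g (X \<omega>) - h (X \<omega>)) + (h (Y \<omega>) - g (Y \<omega>)))\<^sup>2 \<le>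
          2 * (g (X \<omega>) - h (X \<omega>))\<^sup>2 + 2 * (g (Y \<omega>) - h (Y \<omega>))\<^sup>2"
        using sq_sum_le[of "g (X \<omega>) - h (X \<omega>)" "h (Y \<omega>) - g (Y \<omega>)"]
        by (simp add: power2_commute[of "h (Y \<omega>)"])
      ultimately show "(g (X \<omega>) - g (Y \<omega>))\<^sup>2 \<le>
          4 * (g (X \<omega>) - h (X \<omega>))\<^sup>2 + 4 * (g (Y \<omega>) - h (Y \<omega>))\<^sup>2 + 2 * L\<^sup>2 * (X \<omega> - Y \<omega>)\<^sup>2"
        by (simp add: power_mult_distrib)
    qed (use i in auto)
    also have "\<dots> = 4 * expectation (\<lambda>\<omega>. (g (X \<omega>) - h (X \<omega>))\<^sup>2)
        + 4 * expectation (\<lambda>\<omega>. (g (Y \<omega>) - h (Y \<omega>))\<^sup>2) + 2 * L\<^sup>2 * expectation (\<lambda>\<omega>. (X \<omega> - Y \<omega>)\<^sup>2)"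
      using i by simp
    also have "2 * L\<^sup>2 * expectation (\<lambda>\<omega>. (X \<omega> - Y \<omega>)\<^sup>2) \<le> 2 * (L\<^sup>2 + 1) * \<delta>"
      using lt by (intro mult_mono) auto
    also have "2 * (L\<^sup>2 + 1) * \<delta> = \<epsilon> / 2"
      using \<open>L\<^sup>2 + 1 > 0\<close> by (simp add: \<delta>_def divide_simps)
    finally show "expectation (\<lambda>\<omega>. (g (X \<omega>) - g (Y \<omega>))\<^sup>2) < \<epsilon>"
      using gh[OF m(1) d(1)] gh[OF m(2) d(2)] by simp
  qed
qed

end

subsection \<open>Mean-square integrals\<close>

text \<open>\<open>has_ms_integral\<close> constrains only fine tagged partitions, so it has content
  only once these exist. Total boundedness gives finitely many balls covering \<open>S\<close>, and
  the cells are the atoms they generate: points are grouped by the set of centres near them.\<close>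

lemma compact_fine_partition:
  fixes S :: "'p::euclidean_space set"
  assumes S: "compact S" and "\<delta> > 0"
  shows "\<exists>P c. finite P \<and> partition_on S P \<and> (\<forall>B\<in>P. B \<in> sets borel \<and> diameter B < \<delta> \<and> c B \<in> B)"
proof -
  define e where "e = \<delta> / 3"
  have "e > 0" using \<open>\<delta> > 0\<close> by (simp add: e_def)
  then obtain F where F: "finite F" "S \<subseteq> (\<Union>x\<in>F. ball x e)"
    using S by (auto simp: compact_eq_totally_bounded)
  define piece where "piece I = {p\<in>S. {k\<in>F. dist k p < e} = I}" for I
  have piece_sub: "piece I \<subseteq> S" for I unfolding piece_def by blast
  have piece_index: "I = {k\<in>F. dist k p < e}" if "p \<in> piece I" for p I
    using that unfolding piece_def by simp
  define P where "P = piece ` Pow F - {{}}"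
  have "finite P" using F by (simp add: P_def)
  have P_I: "piece I \<in> P" if "I \<subseteq> F" "p \<in> piece I" for I p
    unfolding P_def using that by (metis Diff_iff PowI empty_iff image_eqI singletonD)
  have P_E: "\<exists>I. I \<subseteq> F \<and> B = piece I \<and> B \<noteq> {}" if "B \<in> P" for B
    using that unfolding P_def by (metis Diff_iff PowD imageE singletonI)
  have "partition_on S P"
  proof (rule partition_onI)
    show "\<Union>P = S"
    proof
      show "S \<subseteq> \<Union>P"
      proof
        fix p assume "p \<in> S"
        then have "p \<in> piece {k\<in>F. dist k p < e}" by (simp add: piece_def)
        then show "p \<in> \<Union>P" by (metis P_I UnionI Collect_subset mem_Collect_eq subsetI)
      qed
      show "\<Union>P \<subseteq> S" using P_E piece_sub by (metis Union_least)
    qed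
    show "disjnt B B'" if "B \<in> P" "B' \<in> P" "B \<noteq> B'" for B B'
    proof -
      obtain I where I: "B = piece I" using P_E[OF \<open>B \<in> P\<close>] by metis
      obtain I' where I': "B' = piece I'" using P_E[OF \<open>B' \<in> P\<close>] by metis
      have "B = B'" if "p \<in> B" "p \<in> B'" for p
        using piece_index[of p I] piece_index[of p I'] that unfolding I I' by metis
      then show ?thesis using \<open>B \<noteq> B'\<close> by (metis disjnt_iff)
    qed
    show "{} \<notin> P" by (simp add: P_def)
  qed
  moreover have "B \<in> sets borel \<and> diameter B < \<delta> \<and> (SOME p. p \<in> B) \<in> B" if BP: "B \<in> P" for B
  proof (intro conjI)
    obtain I where I: "I \<subseteq> F" "B = piece I" "B \<noteq> {}"
      using P_E[OF BP] by metis
    have "B = S \<inter> (\<Inter>k\<in>I. ball k e) \<inter> (\<Inter>k\<in>F - I. - ball k e)"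
    proof -
      have "p \<in> piece I \<longleftrightarrow> p \<in> S \<and> (\<forall>k\<in>I. dist k p < e) \<and> (\<forall>k\<in>F - I. \<not> dist k p < e)" for p
        using I(1) unfolding piece_def by blast
      then show ?thesis unfolding I(2) by auto
    qed
    also have "\<dots> \<in> sets borel"
      using F(1) finite_subset[OF I(1) F(1)] S
      by (intro sets.Int borel_compact borel_open open_INT borel_closed closed_INT ballI closed_Compl) auto
    finally show "B \<in> sets borel" .
    obtain p where "p \<in> B" using I by auto
    have "p \<in> S" using \<open>p \<in> B\<close> I piece_sub by blast
    then obtain k where "k \<in> F" "dist k p < e" using F by auto
    then have k: "k \<in> I" using piece_index[of p I] \<open>p \<in> B\<close> I(2) by (metis (mono_tags, lifting) mem_Collect_eq)
    \<comment> \<open>A nonempty cell lies in one of the covering balls, whose radius is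
      \<delta>/3.\<close>
    have "diameter B \<le> 2 * e"
    proof (rule diameter_le)
      fix x y assume "x \<in> B" "y \<in> B"
      then have "dist k x < e" "dist k y < e" using k I(2) piece_index by (metis (mono_tags, lifting) mem_Collect_eq)+
      then have "dist x y \<le> 2 * e" using dist_triangle3[of x y k] by linarith
      then show "norm (x - y) \<le> 2 * e" by (simp add: dist_norm)
    qed (use \<open>e > 0\<close> in auto)
    then show "diameter B < \<delta>" using \<open>\<delta> > 0\<close> by (simp add: e_def)
    show "(SOME p. p \<in> B) \<in> B" using \<open>p \<in> B\<close> by (rule someI)
  qed
  ultimately show ?thesis
    using \<open>finite P\<close> by (intro exI[of _ P] exI[of _ "\<lambda>B. SOME p. p \<in> B"]) blast
qed

text \<open>Cauchy-Schwarz against the constant 1 on each path, followed by Fubini. Integrability of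
  a path is itself a consequence of Fubini and so holds only almost surely.\<close>

lemma integral_random_field_L2_bound:
  fixes d :: "'p \<Rightarrow> 'w \<Rightarrow> real"
  assumes N: "finite_measure N" and M: "prob_space M"
    and meas[measurable]: "(\<lambda>(p, \<omega>). d p \<omega>) \<in> borel_measurable (N \<Otimes>\<^sub>M M)"
    and sq: "\<And>p. p \<in> space N \<Longrightarrow> sq_integrable M (d p)"
    and bnd: "\<And>p. p \<in> space N \<Longrightarrow> (LINT \<omega>|M. (d p \<omega>)\<^sup>2) \<le> c"
  shows "AE \<omega> in M. integrable N (\<lambda>p. d p \<omega>)"
    and "sq_integrable M (\<lambda>\<omega>. LINT p|N. d p \<omega>)"
    and "(LINT \<omega>|M. (LINT p|N. d p \<omega>)\<^sup>2) \<le> (measure N (space N))\<^sup>2 * c"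
proof -
  interpret N: finite_measure N by fact
  interpret M: prob_space M by fact
  interpret NM: pair_sigma_finite N M ..
  have swap[measurable]: "(\<lambda>(\<omega>, p). d p \<omega>) \<in> borel_measurable (M \<Otimes>\<^sub>M N)"
    using measurable_compose[OF measurable_pair_swap' meas] by (simp add: case_prod_beta')
  have "integrable N (\<lambda>p. LINT \<omega>|M. (d p \<omega>)\<^sup>2)"
    by (rule N.integrable_const_bound[of _ c]) (use bnd in auto)
  then have int: "integrable (N \<Otimes>\<^sub>M M) (\<lambda>(p, \<omega>). (d p \<omega>)\<^sup>2)"
    using sq by (intro NM.Fubini_integrable AE_I2) (auto simp: sq_integrable_def)
  have AE2: "AE \<omega> in M. sq_integrable N (\<lambda>p. d p \<omega>)"
  proof -
    have "AE \<omega> in M. integrable N (\<lambda>p. (d p \<omega>)\<^sup>2)"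
      by (rule NM.AE_integrable_snd[OF int])
    with AE_space show ?thesis
      by eventually_elim (simp add: sq_integrable_def)
  qed
  then show "AE \<omega> in M. integrable N (\<lambda>p. d p \<omega>)"
    by eventually_elim (rule N.sq_integrable_imp_integrable)
  have D[measurable]: "(\<lambda>\<omega>. LINT p|N. d p \<omega>) \<in> borel_measurable M"
    by (rule N.borel_measurable_lebesgue_integral) (rule swap)
  have le: "AE \<omega> in M. (LINT p|N. d p \<omega>)\<^sup>2 \<le> measure N (space N) * (LINT p|N. (d p \<omega>)\<^sup>2)"
    using AE2
  proof eventually_elim
    case (elim \<omega>)
    show ?case
      using integral_Cauchy_Schwarz[OF elim N.sq_integrable_const[of 1]] by (simp add: mult.commute)
  qed
  have int': "integrable M (\<lambda>\<omega>. measure N (space N) * (LINT p|N. (d p \<omega>)\<^sup>2))"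
    by (intro integrable_mult_right NM.integrable_snd[OF int])
  then show sqD: "sq_integrable M (\<lambda>\<omega>. LINT p|N. d p \<omega>)"
    unfolding sq_integrable_def using le
    by (auto intro!: Bochner_Integration.integrable_bound[OF int'] elim: eventually_mono)
  have "(LINT \<omega>|M. (LINT p|N. d p \<omega>)\<^sup>2) \<le> (LINT \<omega>|M. measure N (space N) * (LINT p|N. (d p \<omega>)\<^sup>2))"
    using int' sqD le by (intro integral_mono_AE) (auto simp: sq_integrable_def)
  also have "\<dots> = measure N (space N) * (LINT p|N. LINT \<omega>|M. (d p \<omega>)\<^sup>2)"
    using NM.Fubini_integral[OF int] by simp
  also have "(LINT p|N. LINT \<omega>|M. (d p \<omega>)\<^sup>2) \<le> (LINT p|N. c)"
    using \<open>integrable N (\<lambda>p. LINT \<omega>|M. (d p \<omega>)\<^sup>2)\<close> bnd by (intro integral_mono) auto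
  also have "(LINT p|N. c) = measure N (space N) * c" by simp
  finally show "(LINT \<omega>|M. (LINT p|N. d p \<omega>)\<^sup>2) \<le> (measure N (space N))\<^sup>2 * c"
    by (simp add: power2_eq_square mult.assoc mult_left_mono)
qed

text \<open>The pathwise Lebesgue integral is a version of the mean-square integral: a Riemann sum differs
  from it by the pathwise integral of \<open>\<xi> p - \<xi> (c B)\<close>, which is small in \<open>L\<^sub>2\<close> uniformly in \<open>p\<close>.\<close>

lemma has_ms_integral_pathwise:
  fixes \<xi> :: "'p::euclidean_space \<Rightarrow> 'w \<Rightarrow> real"
  assumes M: "prob_space M" and S: "compact S"
    and meas: "(\<lambda>(p, \<omega>). \<xi> p \<omega>) \<in> borel_measurable (borel \<Otimes>\<^sub>M M)"
    and sq: "\<And>p. p \<in> S \<Longrightarrow> sq_integrable M (\<xi> p)"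
    and bnd: "\<And>p. p \<in> S \<Longrightarrow> (LINT \<omega>|M. (\<xi> p \<omega>)\<^sup>2) \<le> b"
    and cont: "\<And>\<epsilon>. \<epsilon> > 0 \<Longrightarrow> \<exists>\<delta>>0. \<forall>p\<in>S. \<forall>q\<in>S. dist p q < \<delta> \<longrightarrow> (LINT \<omega>|M. (\<xi> p \<omega> - \<xi> q \<omega>)\<^sup>2) < \<epsilon>"
  shows "has_ms_integral M \<xi> S (\<lambda>\<omega>. LINT p|restrict_space lborel S. \<xi> p \<omega>)"
proof -
  interpret M: prob_space M by fact
  define N where "N = restrict_space lborel S"
  have Sb[measurable]: "S \<in> sets borel" using S by (rule borel_compact)
  have spN: "space N = S" by (simp add: N_def space_restrict_space)
  have finN: "finite_measure N"
    unfolding N_def using emeasure_compact_finite[OF S] Sb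
    by (intro finite_measureI) (simp add: emeasure_restrict_space space_restrict_space less_top)
  interpret N: finite_measure N by fact
  have id[measurable]: "(\<lambda>p. p) \<in> borel_measurable N"
    unfolding N_def by (rule measurable_restrict_space1) simp
  have meas'[measurable]: "(\<lambda>(p, \<omega>). \<xi> p \<omega>) \<in> borel_measurable (N \<Otimes>\<^sub>M M)"
  proof -
    have "(\<lambda>x. (fst x, snd x)) \<in> N \<Otimes>\<^sub>M M \<rightarrow>\<^sub>M borel \<Otimes>\<^sub>M M"
      using measurable_compose[OF measurable_fst id] by (intro measurable_Pair) auto
    from measurable_compose[OF this meas] show ?thesis by (simp add: case_prod_beta')
  qed
  define X where "X \<omega> = (LINT p|N. \<xi> p \<omega>)" for \<omega>
  have X: "AE \<omega> in M. integrable N (\<lambda>p. \<xi> p \<omega>)" "sq_integrable M X"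
    using integral_random_field_L2_bound(1,2)[OF finN M meas', of b] sq bnd
    by (auto simp: spN X_def[abs_def])
  have "has_ms_integral M \<xi> S X"
    unfolding has_ms_integral_def
  proof (intro conjI ballI allI impI)
    fix \<epsilon> :: real assume "\<epsilon> > 0"
    \<comment> \<open>The final bound is the squared volume times \<eta>; the added 1 makes it
      strictly less than \<epsilon>, even for volume 0.\<close>
    define \<eta> where "\<eta> = \<epsilon> / ((measure N (space N))\<^sup>2 + 1)"
    have pos: "(measure N (space N))\<^sup>2 + 1 > 0" by (simp add: add_nonneg_pos)
    then have "\<eta> > 0" using \<open>\<epsilon> > 0\<close> by (simp add: \<eta>_def)
    then obtain \<delta> where "\<delta> > 0" and \<delta>: "\<And>p q. p \<in> S \<Longrightarrow> q \<in> S \<Longrightarrow> dist p q < \<delta> \<Longrightarrow> (LINT \<omega>|M. (\<xi> p \<omega> - \<xi> q \<omega>)\<^sup>2) < \<eta>"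
      using cont[OF \<open>\<eta> > 0\<close>] by blast
    have "(LINT \<omega>|M. (X \<omega> - (\<Sum>B\<in>P. measure lborel B * \<xi> (c B) \<omega>))\<^sup>2) < \<epsilon>"
      if "finite P" "partition_on S P" and P: "\<forall>B\<in>P. B \<in> sets borel \<and> diameter B < \<delta> \<and> c B \<in> B" for P c
    proof -
      have BS: "B \<subseteq> S" if "B \<in> P" for B
        using \<open>partition_on S P\<close> that by (auto simp: partition_on_def)
      have BN[measurable]: "B \<in> sets N" if "B \<in> P" for B
        using P BS[OF that] that Sb by (simp add: N_def sets_restrict_space_iff)
      have mB: "measure N B = measure lborel B" if "B \<in> P" for B
        using BS[OF that] Sb by (simp add: N_def measure_restrict_space)
      \<comment> \<open>The field minus its step version: every point lies in exactly one cell, so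
        the sum collapses to the value at that cell's tag.\<close>
      define d where "d p \<omega> = \<xi> p \<omega> - (\<Sum>B\<in>P. indicator B p * \<xi> (c B) \<omega>)" for p \<omega>
      have cS: "c B \<in> S" if "B \<in> P" for B using P BS that by blast
      have d_eq: "d p = (\<lambda>\<omega>. \<xi> p \<omega> - \<xi> (c B) \<omega>)" if "B \<in> P" "p \<in> B" for p B
      proof
        fix \<omega>
        have "(\<Sum>B'\<in>P. indicator B' p * \<xi> (c B') \<omega>) = (\<Sum>B'\<in>P. if B' = B then \<xi> (c B) \<omega> else 0)"
        proof (rule sum.cong[OF refl])
          fix B' assume "B' \<in> P"
          then have "B' \<noteq> B \<Longrightarrow> p \<notin> B'"
            using \<open>partition_on S P\<close> that by (auto simp: partition_on_def disjoint_def)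
          then show "indicator B' p * \<xi> (c B') \<omega> = (if B' = B then \<xi> (c B) \<omega> else 0)"
            using that by auto
        qed
        also have "\<dots> = \<xi> (c B) \<omega>" using \<open>finite P\<close> that by simp
        finally show "d p \<omega> = \<xi> p \<omega> - \<xi> (c B) \<omega>" by (simp add: d_def)
      qed
      have piece: "\<exists>B\<in>P. p \<in> B" if "p \<in> S" for p
        using \<open>partition_on S P\<close> that by (auto simp: partition_on_def)
      have sqd: "sq_integrable M (d p)" and bd: "(LINT \<omega>|M. (d p \<omega>)\<^sup>2) \<le> \<eta>" if "p \<in> space N" for p
      proof -
        have "p \<in> S" using that by (simp add: spN)
        then obtain B where B: "B \<in> P" "p \<in> B" using piece by blast
        show "sq_integrable M (d p)"
          unfolding d_eq[OF B] using that cS[OF B(1)] by (intro sq_integrable_diff sq) (auto simp: spN)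
        \<comment> \<open>The diameter bounds distances only within a bounded set.\<close>
        have "bounded B" using BS[OF B(1)] S bounded_subset compact_imp_bounded by blast
        then have "dist p (c B) < \<delta>"
          using diameter_bounded_bound[of B p "c B"] P B by fastforce
        then show "(LINT \<omega>|M. (d p \<omega>)\<^sup>2) \<le> \<eta>"
          unfolding d_eq[OF B] using \<delta>[of p "c B"] that cS[OF B(1)] by (simp add: spN)
      qed
      have measd: "(\<lambda>(p, \<omega>). d p \<omega>) \<in> borel_measurable (N \<Otimes>\<^sub>M M)"
      proof -
        have "(\<lambda>x. \<xi> (c B) (snd x)) \<in> borel_measurable (N \<Otimes>\<^sub>M M)"
             "(\<lambda>x. indicator B (fst x) :: real) \<in> borel_measurable (N \<Otimes>\<^sub>M M)" if "B \<in> P" for B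
          using sq_integrable_measurable[OF sq[OF cS[OF that]]] BN[OF that]
          by (auto intro: measurable_compose[OF measurable_snd] measurable_compose[OF measurable_fst])
        then show ?thesis
          using meas' unfolding d_def case_prod_beta'
          by (intro borel_measurable_diff borel_measurable_sum borel_measurable_times) auto
      qed
      note L2b = integral_random_field_L2_bound[OF finN M measd sqd bd]
      have "AE \<omega> in M. (LINT p|N. d p \<omega>) = X \<omega> - (\<Sum>B\<in>P. measure lborel B * \<xi> (c B) \<omega>)"
        using X(1)
      proof eventually_elim
        case (elim \<omega>)
        have i: "integrable N (\<lambda>p. indicator B p * \<xi> (c B) \<omega>)" if "B \<in> P" for B
          using BN[OF that] by (intro integrable_mult_left) (simp add: less_top[symmetric])
        have "(LINT p|N. d p \<omega>) = X \<omega> - (\<Sum>B\<in>P. LINT p|N. indicator B p * \<xi> (c B) \<omega>)"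
          unfolding d_def X_def using elim i by simp
        also have "(\<Sum>B\<in>P. LINT p|N. indicator B p * \<xi> (c B) \<omega>) = (\<Sum>B\<in>P. measure lborel B * \<xi> (c B) \<omega>)"
          using BN mB BS by (intro sum.cong) (auto simp: spN Int_absorb2)
        finally show ?case .
      qed
      moreover have "(\<lambda>\<omega>. LINT p|N. d p \<omega>) \<in> borel_measurable M"
        using L2b(2) by (rule sq_integrable_measurable)
      moreover have "(\<lambda>\<omega>. X \<omega> - (\<Sum>B\<in>P. measure lborel B * \<xi> (c B) \<omega>)) \<in> borel_measurable M"
        using X(2) sq cS by (intro borel_measurable_diff borel_measurable_sum borel_measurable_times)
          (auto dest: sq_integrable_measurable)
      ultimately have "(LINT \<omega>|M. (X \<omega> - (\<Sum>B\<in>P. measure lborel B * \<xi> (c B) \<omega>))\<^sup>2) = (LINT \<omega>|M. (LINT p|N. d p \<omega>)\<^sup>2)"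
        by (intro integral_cong_AE) auto
      also have "\<dots> \<le> (measure N (space N))\<^sup>2 * \<eta>" by (rule L2b(3))
      also have "\<dots> < ((measure N (space N))\<^sup>2 + 1) * \<eta>" using \<open>\<eta> > 0\<close> by (simp add: distrib_right)
      also have "\<dots> = \<epsilon>" using pos by (simp add: \<eta>_def)
      finally show ?thesis .
    qed
    with \<open>\<delta> > 0\<close> show "\<exists>\<delta>>0. \<forall>P c. finite P \<and> partition_on S P \<and>
        (\<forall>B\<in>P. B \<in> sets borel \<and> diameter B < \<delta> \<and> c B \<in> B) \<longrightarrow>
        (LINT \<omega>|M. (X \<omega> - (\<Sum>B\<in>P. measure lborel B * \<xi> (c B) \<omega>))\<^sup>2) < \<epsilon>"
      by blast
  qed (use X(2) sq in \<open>auto simp: sq_integrable_def\<close>)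
  then show ?thesis by (simp add: X_def[abs_def] N_def)
qed

subsection \<open>Projection onto the Hermite polynomial of rank \<open>m\<close>\<close>

lemma L2_gauss_iff_sq_integrable: "L2_gauss g \<longleftrightarrow> sq_integrable std_normal_distribution g"
proof -
  have "g \<in> borel_measurable borel \<Longrightarrow> integrable std_normal_distribution (\<lambda>x. (g x)\<^sup>2) \<longleftrightarrow>
      integrable lborel (\<lambda>z. (g z)\<^sup>2 * std_normal_density z)"
    by (simp add: integrable_density mult.commute)
  then show ?thesis by (auto simp: sq_integrable_def L2_gauss_def)
qed

lemma integrable_L2_gauss_mult:
  assumes "L2_gauss f" "L2_gauss g"
  shows "integrable lborel (\<lambda>z. f z * g z * std_normal_density z)"
proof -
  have [measurable]: "f \<in> borel_measurable borel" "g \<in> borel_measurable borel"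
    using assms by (auto simp: L2_gauss_def)
  have "integrable std_normal_distribution (\<lambda>z. f z * g z)"
    using assms by (intro integrable_mult_sq_integrable) (simp_all add: L2_gauss_iff_sq_integrable)
  then show ?thesis by (simp add: integrable_density mult.commute)
qed

text \<open>As \<open>fact n\<close> is the squared norm of \<open>H\<^sub>n\<close>, the multiple
  \<open>\<kappa> H\<^sub>n\<close> is the orthogonal projection of \<open>g\<close> in
  \<open>L\<^sub>2(\<phi>)\<close>.\<close>

lemma hermite_coeff_remainder:
  fixes g :: "real \<Rightarrow> real" and n :: nat
  assumes g: "L2_gauss g"
  defines "\<kappa> \<equiv> hermite_coeff g n / fact n"
  shows "L2_gauss (\<lambda>z. g z - \<kappa> * hermite n z)"
    and "hermite_coeff (\<lambda>z. g z - \<kappa> * hermite n z) n = 0"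
proof -
  show "L2_gauss (\<lambda>z. g z - \<kappa> * hermite n z)"
    using g L2_gauss_hermite[of n] by (simp add: L2_gauss_iff_sq_integrable sq_integrable_diff sq_integrable_cmult)
  have "hermite_coeff (\<lambda>z. g z - \<kappa> * hermite n z) n =
      (LINT z|lborel. g z * hermite n z * std_normal_density z - \<kappa> * (hermite n z * hermite n z * std_normal_density z))"
    by (simp add: hermite_coeff_def algebra_simps)
  also have "\<dots> = hermite_coeff g n - \<kappa> * hermite_coeff (hermite n) n"
    using integrable_L2_gauss_mult[OF g L2_gauss_hermite[of n]]
      integrable_L2_gauss_mult[OF L2_gauss_hermite[of n] L2_gauss_hermite[of n]]
    by (simp add: hermite_coeff_def)
  also have "\<dots> = 0" by (simp add: hermite_coeff_hermite \<kappa>_def)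
  finally show "hermite_coeff (\<lambda>z. g z - \<kappa> * hermite n z) n = 0" .
qed

section \<open>From Riemann sums to orthogonality of mean-square integrals\<close>

lemma has_ms_integral_sq_integrable: "has_ms_integral M \<xi> S X \<Longrightarrow> sq_integrable M X"
  by (simp add: has_ms_integral_def sq_integrable_def)

lemma has_ms_integral_mesh:
  fixes S :: "'p::euclidean_space set"
  assumes X: "has_ms_integral M \<xi> S X" and "\<epsilon> > 0"
  shows "\<exists>\<delta>>0. \<forall>P c. finite P \<and> partition_on S P \<and>
      (\<forall>B\<in>P. B \<in> sets borel \<and> diameter B < \<delta> \<and> c B \<in> B) \<longrightarrow>
      (LINT \<omega>|M. (X \<omega> - (\<Sum>B\<in>P. measure lborel B * \<xi> (c B) \<omega>))\<^sup>2) < \<epsilon>"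
proof -
  have "\<forall>\<epsilon>>0. \<exists>\<delta>>0. \<forall>P c. finite P \<and> partition_on S P \<and>
      (\<forall>B\<in>P. B \<in> sets borel \<and> diameter B < \<delta> \<and> c B \<in> B) \<longrightarrow>
      (LINT \<omega>|M. (X \<omega> - (\<Sum>B\<in>P. measure lborel B * \<xi> (c B) \<omega>))\<^sup>2) < \<epsilon>"
    using X unfolding has_ms_integral_def by (elim conjE)
  then show ?thesis using \<open>\<epsilon> > 0\<close> by (elim allE impE)
qed

text \<open>The two integrals share one tagged partition, finer than both thresholds, so that linear
  combinations of their Riemann sums can be formed term by term.\<close>

lemma has_ms_integral_riemann_sums:
  fixes S :: "'p::euclidean_space set"
  assumes X: "has_ms_integral M \<xi> S X" and Y: "has_ms_integral M \<eta> S Y"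
    and S: "compact S" and "\<epsilon> > 0"
  obtains P :: "'p set set" and c where "finite P"
    "(LINT \<omega>|M. (X \<omega> - (\<Sum>B\<in>P. measure lborel B * \<xi> (c B) \<omega>))\<^sup>2) < \<epsilon>"
    "(LINT \<omega>|M. (Y \<omega> - (\<Sum>B\<in>P. measure lborel B * \<eta> (c B) \<omega>))\<^sup>2) < \<epsilon>"
proof -
  obtain \<delta>1 where "\<delta>1 > 0" and 1: "\<forall>P c. finite P \<and> partition_on S P \<and>
      (\<forall>B\<in>P. B \<in> sets borel \<and> diameter B < \<delta>1 \<and> c B \<in> B) \<longrightarrow>
      (LINT \<omega>|M. (X \<omega> - (\<Sum>B\<in>P. measure lborel B * \<xi> (c B) \<omega>))\<^sup>2) < \<epsilon>"
    using has_ms_integral_mesh[OF X \<open>\<epsilon> > 0\<close>] by (elim exE conjE)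
  obtain \<delta>2 where "\<delta>2 > 0" and 2: "\<forall>P c. finite P \<and> partition_on S P \<and>
      (\<forall>B\<in>P. B \<in> sets borel \<and> diameter B < \<delta>2 \<and> c B \<in> B) \<longrightarrow>
      (LINT \<omega>|M. (Y \<omega> - (\<Sum>B\<in>P. measure lborel B * \<eta> (c B) \<omega>))\<^sup>2) < \<epsilon>"
    using has_ms_integral_mesh[OF Y \<open>\<epsilon> > 0\<close>] by (elim exE conjE)
  obtain P c where P: "finite P" "partition_on S P"
      "\<forall>B\<in>P. B \<in> sets borel \<and> diameter B < min \<delta>1 \<delta>2 \<and> c B \<in> B"
    using compact_fine_partition[OF S, of "min \<delta>1 \<delta>2"] \<open>\<delta>1 > 0\<close> \<open>\<delta>2 > 0\<close> by auto
  have P1: "\<forall>B\<in>P. B \<in> sets borel \<and> diameter B < \<delta>1 \<and> c B \<in> B"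
    and P2: "\<forall>B\<in>P. B \<in> sets borel \<and> diameter B < \<delta>2 \<and> c B \<in> B"
    using P(3) by auto
  show thesis
    by (rule that[OF P(1) 1[THEN spec, THEN spec, THEN mp, OF conjI[OF P(1) conjI[OF P(2) P1]]]
        2[THEN spec, THEN spec, THEN mp, OF conjI[OF P(1) conjI[OF P(2) P2]]]])
qed

context prob_space
begin

lemma ms_integral_hermite_projection:
  fixes Z :: "'p::euclidean_space \<Rightarrow> 'a \<Rightarrow> real"
  assumes Z: "\<And>p q. standard_gaussian_pair (Z p) (Z q) (\<rho> p q)"
    and S: "compact S" and g: "L2_gauss g" and "m \<ge> 1"
    and X: "has_ms_integral M (\<lambda>p \<omega>. g (Z p \<omega>)) S X"
    and H: "has_ms_integral M (\<lambda>p \<omega>. hermite m (Z p \<omega>)) S H"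
  defines "\<kappa> \<equiv> hermite_coeff g m / fact m"
  shows "expectation H = 0" and "expectation (\<lambda>\<omega>. (X \<omega> - \<kappa> * H \<omega>) * H \<omega>) = 0"
proof -
  define h where "h z = g z - \<kappa> * hermite m z" for z
  have h: "L2_gauss h" "hermite_coeff h m = 0"
    using hermite_coeff_remainder[OF g, of m] by (simp_all add: h_def[abs_def] \<kappa>_def)
  note marg = standard_gaussian_pair_marginal(1,3)[OF Z]
  note sX = has_ms_integral_sq_integrable[OF X] and sH = has_ms_integral_sq_integrable[OF H]
  have sq: "sq_integrable M (\<lambda>\<omega>. f (Z p \<omega>))" if "L2_gauss f" for f p
    by (rule sq_integrable_L2_gauss(1)[OF marg that])
  note sq' = sq[OF g] sq[OF h(1)] sq[OF L2_gauss_hermite[of m]]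
  have sum_sq: "sq_integrable M (\<lambda>\<omega>. \<Sum>B\<in>P. measure lborel B * f (Z (c B) \<omega>))"
    if "L2_gauss f" for f and P :: "'p set set" and c
    by (intro sq_integrable_sum sq_integrable_cmult sq that)
  have mean: "expectation (\<lambda>\<omega>. hermite m (Z p \<omega>)) = 0" for p
    using standard_normal_integral(1)[OF marg, of "hermite m"] integral_hermite_eq_0[OF \<open>m \<ge> 1\<close>]
      L2_gauss_hermite[of m] by (simp add: L2_gauss_def mult.commute)
  have orth: "expectation (\<lambda>\<omega>. h (Z p \<omega>) * hermite m (Z q \<omega>)) = 0" for p q
    using standard_gaussian_pair_hermite[OF Z h(1)] h(2) by simp
  \<comment> \<open>The mean is written as an inner product with the constant 1, so that the
    approximation lemma applies here as well.\<close>
  have "expectation (\<lambda>\<omega>. H \<omega> * 1) = 0"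
  proof (rule integral_mult_eq_0_by_L2_approximation[OF sH sq_integrable_const])
    fix \<epsilon> :: real assume "\<epsilon> > 0"
    obtain P :: "'p set set" and c where P: "finite P"
      "expectation (\<lambda>\<omega>. (H \<omega> - (\<Sum>B\<in>P. measure lborel B * hermite m (Z (c B) \<omega>)))\<^sup>2) < \<epsilon>"
      "expectation (\<lambda>\<omega>. (H \<omega> - (\<Sum>B\<in>P. measure lborel B * hermite m (Z (c B) \<omega>)))\<^sup>2) < \<epsilon>"
      by (rule has_ms_integral_riemann_sums[OF H H S \<open>\<epsilon> > 0\<close>])
    let ?U = "\<lambda>\<omega>. \<Sum>B\<in>P. measure lborel B * hermite m (Z (c B) \<omega>)"
    have "expectation (\<lambda>\<omega>. ?U \<omega> * 1) = 0"
      using sq'(3) by (simp add: mean sq_integrable_imp_integrable)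
    moreover have "sq_integrable M ?U"
      by (rule sum_sq[OF L2_gauss_hermite])
    ultimately show "\<exists>U' V'. sq_integrable M U' \<and> sq_integrable M V' \<and>
      expectation (\<lambda>\<omega>. (H \<omega> - U' \<omega>)\<^sup>2) < \<epsilon> \<and> expectation (\<lambda>\<omega>. (1 - V' \<omega>)\<^sup>2) < \<epsilon> \<and> expectation (\<lambda>\<omega>. U' \<omega> * V' \<omega>) = 0"
      using P(3) \<open>\<epsilon> > 0\<close> sq_integrable_const[of 1]
      by (intro exI[of _ ?U] exI[of _ "\<lambda>_. 1"]) auto
  qed
  then show "expectation H = 0" by simp
  show "expectation (\<lambda>\<omega>. (X \<omega> - \<kappa> * H \<omega>) * H \<omega>) = 0"
  proof (rule integral_mult_eq_0_by_L2_approximation)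
    show "sq_integrable M (\<lambda>\<omega>. X \<omega> - \<kappa> * H \<omega>)" "sq_integrable M H"
      using sX sH by (auto intro: sq_integrable_diff sq_integrable_cmult)
    fix \<epsilon> :: real assume "\<epsilon> > 0"
    \<comment> \<open>The error of \<open>X - \<kappa> H\<close> is below
      \<open>2 e + 2 \<kappa>\<^sup>2 e\<close>, which is \<epsilon>; since
      \<open>e \<le> \<epsilon>\<close>, the error of \<open>H\<close> is small enough too.\<close>
    define e where "e = \<epsilon> / (2 + 2 * \<kappa>\<^sup>2)"
    have pos: "2 + 2 * \<kappa>\<^sup>2 > 0" by (simp add: add_pos_nonneg)
    have "e > 0" "e \<le> \<epsilon>"
      using \<open>\<epsilon> > 0\<close> pos mult_left_mono[of 1 "2 + 2 * \<kappa>\<^sup>2" \<epsilon>] by (auto simp: e_def divide_le_eq)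
    obtain P :: "'p set set" and c where P: "finite P"
      and aX: "expectation (\<lambda>\<omega>. (X \<omega> - (\<Sum>B\<in>P. measure lborel B * g (Z (c B) \<omega>)))\<^sup>2) < e"
      and aH: "expectation (\<lambda>\<omega>. (H \<omega> - (\<Sum>B\<in>P. measure lborel B * hermite m (Z (c B) \<omega>)))\<^sup>2) < e"
      by (rule has_ms_integral_riemann_sums[OF X H S \<open>e > 0\<close>])
    define U where "U \<omega> = (\<Sum>B\<in>P. measure lborel B * h (Z (c B) \<omega>))" for \<omega>
    define Ug where "Ug \<omega> = (\<Sum>B\<in>P. measure lborel B * g (Z (c B) \<omega>))" for \<omega>
    define V where "V \<omega> = (\<Sum>B\<in>P. measure lborel B * hermite m (Z (c B) \<omega>))" for \<omega>
    have U_eq: "U \<omega> = Ug \<omega> - \<kappa> * V \<omega>" for \<omega>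
      by (simp add: U_def Ug_def V_def h_def sum_distrib_left right_diff_distrib sum_subtractf mult.left_commute)
    have sU: "sq_integrable M U" and sUg: "sq_integrable M Ug" and sV: "sq_integrable M V"
      unfolding U_def[abs_def] Ug_def[abs_def] V_def[abs_def] by (rule sum_sq[OF h(1)] sum_sq[OF g] sum_sq[OF L2_gauss_hermite])+
    \<comment> \<open>Every term of the double sum vanishes, since \<open>orth\<close> holds for any
      two tags whatever their correlation.\<close>
    have UV: "expectation (\<lambda>\<omega>. U \<omega> * V \<omega>) = 0"
    proof -
      have "expectation (\<lambda>\<omega>. U \<omega> * V \<omega>) = expectation (\<lambda>\<omega>. \<Sum>B\<in>P. \<Sum>B'\<in>P.
          measure lborel B * measure lborel B' * (h (Z (c B) \<omega>) * hermite m (Z (c B') \<omega>)))"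
        by (simp add: U_def V_def sum_product mult_ac)
      also have "\<dots> = (\<Sum>B\<in>P. \<Sum>B'\<in>P. measure lborel B * measure lborel B' *
          expectation (\<lambda>\<omega>. h (Z (c B) \<omega>) * hermite m (Z (c B') \<omega>)))"
        using integrable_mult_sq_integrable[OF sq'(2,3)] by simp
      finally show ?thesis by (simp add: orth)
    qed
    have i: "integrable M (\<lambda>\<omega>. (X \<omega> - Ug \<omega>)\<^sup>2)" "integrable M (\<lambda>\<omega>. (H \<omega> - V \<omega>)\<^sup>2)"
      "integrable M (\<lambda>\<omega>. (X \<omega> - \<kappa> * H \<omega> - U \<omega>)\<^sup>2)"
      using sX sH sU sUg sV by (auto intro!: sq_integrable_square sq_integrable_diff sq_integrable_cmult)
    have "expectation (\<lambda>\<omega>. (X \<omega> - \<kappa> * H \<omega> - U \<omega>)\<^sup>2) \<le>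
        expectation (\<lambda>\<omega>. 2 * (X \<omega> - Ug \<omega>)\<^sup>2 + 2 * \<kappa>\<^sup>2 * (H \<omega> - V \<omega>)\<^sup>2)"
    proof (intro integral_mono i)
      fix \<omega>
      show "(X \<omega> - \<kappa> * H \<omega> - U \<omega>)\<^sup>2 \<le> 2 * (X \<omega> - Ug \<omega>)\<^sup>2 + 2 * \<kappa>\<^sup>2 * (H \<omega> - V \<omega>)\<^sup>2"
      proof -
        have eq: "X \<omega> - \<kappa> * H \<omega> - U \<omega> = (X \<omega> - Ug \<omega>) + - \<kappa> * (H \<omega> - V \<omega>)"
          by (simp add: U_eq algebra_simps)
        show ?thesis
          unfolding eq using sq_sum_le[of "X \<omega> - Ug \<omega>" "- \<kappa> * (H \<omega> - V \<omega>)"]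
          by (simp add: power_mult_distrib mult.assoc)
      qed
    qed (use i in auto)
    also have "\<dots> = 2 * expectation (\<lambda>\<omega>. (X \<omega> - Ug \<omega>)\<^sup>2) + 2 * \<kappa>\<^sup>2 * expectation (\<lambda>\<omega>. (H \<omega> - V \<omega>)\<^sup>2)"
      using i by simp
    also have "\<dots> < 2 * e + 2 * \<kappa>\<^sup>2 * e"
      using aX aH unfolding Ug_def[symmetric] V_def[symmetric]
      by (intro add_less_le_mono mult_left_mono) auto
    also have "\<dots> = (2 + 2 * \<kappa>\<^sup>2) * e" by (simp add: distrib_right)
    also have "\<dots> = \<epsilon>" using pos by (simp add: e_def)
    finally have "expectation (\<lambda>\<omega>. (X \<omega> - \<kappa> * H \<omega> - U \<omega>)\<^sup>2) < \<epsilon>" .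
    with aH \<open>e \<le> \<epsilon>\<close> UV sU sV show "\<exists>U' V'. sq_integrable M U' \<and> sq_integrable M V' \<and>
      expectation (\<lambda>\<omega>. (X \<omega> - \<kappa> * H \<omega> - U' \<omega>)\<^sup>2) < \<epsilon> \<and> expectation (\<lambda>\<omega>. (H \<omega> - V' \<omega>)\<^sup>2) < \<epsilon> \<and>
      expectation (\<lambda>\<omega>. U' \<omega> * V' \<omega>) = 0"
      unfolding V_def[symmetric] by (intro exI[of _ U] exI[of _ V]) auto
  qed
qed

text \<open>Pythagoras for \<open>R\<close> and \<open>\<kappa> H\<close>. The mean of
  \<open>X\<close> need not be 0, but subtracting it preserves orthogonality because
  \<open>H\<close> has mean 0.\<close>

lemma variance_orthogonal_decomposition:
  assumes X: "sq_integrable M X" and H: "sq_integrable M H"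
    and mean: "expectation H = 0" and orth: "expectation (\<lambda>\<omega>. (X \<omega> - \<kappa> * H \<omega>) * H \<omega>) = 0"
  shows "variance X = expectation (\<lambda>\<omega>. (X \<omega> - expectation X - \<kappa> * H \<omega>)\<^sup>2) + \<kappa>\<^sup>2 * variance H"
proof -
  define R where "R \<omega> = X \<omega> - expectation X - \<kappa> * H \<omega>" for \<omega>
  have R: "sq_integrable M R"
    unfolding R_def using X H by (intro sq_integrable_diff sq_integrable_cmult sq_integrable_const)
  have "expectation (\<lambda>\<omega>. R \<omega> * H \<omega>) =
      expectation (\<lambda>\<omega>. (X \<omega> - \<kappa> * H \<omega>) * H \<omega> - expectation X * H \<omega>)"
    by (simp add: R_def algebra_simps)
  also have "\<dots> = 0"
    using integrable_mult_sq_integrable[OF sq_integrable_diff[OF X sq_integrable_cmult[OF H, of \<kappa>]] H]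
      sq_integrable_imp_integrable[OF H] orth mean by simp
  finally have RH: "expectation (\<lambda>\<omega>. R \<omega> * H \<omega>) = 0" .
  have "variance X = expectation (\<lambda>\<omega>. (R \<omega>)\<^sup>2 + 2 * \<kappa> * (R \<omega> * H \<omega>) + \<kappa>\<^sup>2 * (H \<omega>)\<^sup>2)"
  proof (rule Bochner_Integration.integral_cong[OF refl])
    fix \<omega>
    have "X \<omega> - expectation X = R \<omega> + \<kappa> * H \<omega>" by (simp add: R_def)
    then show "(X \<omega> - expectation X)\<^sup>2 = (R \<omega>)\<^sup>2 + 2 * \<kappa> * (R \<omega> * H \<omega>) + \<kappa>\<^sup>2 * (H \<omega>)\<^sup>2"
      by (simp add: power2_sum power_mult_distrib)
  qed
  also have "\<dots> = expectation (\<lambda>\<omega>. (R \<omega>)\<^sup>2) + \<kappa>\<^sup>2 * expectation (\<lambda>\<omega>. (H \<omega>)\<^sup>2)"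
    using sq_integrable_square[OF R] sq_integrable_square[OF H] integrable_mult_sq_integrable[OF R H] RH
    by simp
  finally show ?thesis using mean by (simp add: R_def)
qed

text \<open>If \<open>\<sigma> = 0\<close>, both quotients in \<open>D\<close> are \<open>0\<close> because \<open>x / 0 = 0\<close>.\<close>

lemma normalised_difference_L2:
  assumes X: "sq_integrable M X" and H: "sq_integrable M H"
    and mean: "expectation H = 0" and orth: "expectation (\<lambda>\<omega>. (X \<omega> - J / c * H \<omega>) * H \<omega>) = 0"
    and "J \<noteq> 0" and "c > 0" and \<sigma>: "\<sigma> = sqrt (variance H)"
  defines "D \<omega> \<equiv> (X \<omega> - expectation X) / (\<bar>J\<bar> * \<sigma> / c) - sgn J * H \<omega> / \<sigma>"
  shows "sq_integrable M D"
    and "expectation (\<lambda>\<omega>. (D \<omega>)\<^sup>2) \<le> max 0 (variance X / (J\<^sup>2 / c\<^sup>2 * \<sigma>\<^sup>2) - 1)"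
proof -
  define R where "R \<omega> = X \<omega> - expectation X - J / c * H \<omega>" for \<omega>
  have R: "sq_integrable M R"
    unfolding R_def using X H by (intro sq_integrable_diff sq_integrable_cmult sq_integrable_const)
  \<comment> \<open>Both quotients share this factor, since \<open>sgn J / \<sigma>\<close> equals
    \<open>c / (\<bar>J\<bar> \<sigma>)\<close> times \<open>J / c\<close>.\<close>
  have D: "D \<omega> = c / (\<bar>J\<bar> * \<sigma>) * R \<omega>" for \<omega>
  proof (cases "\<sigma> = 0")
    case False
    with \<open>J \<noteq> 0\<close> \<open>c > 0\<close> show ?thesis
      by (simp add: D_def R_def field_simps sgn_real_def abs_real_def)
  qed (simp add: D_def)
  show "sq_integrable M D"
    unfolding D[abs_def] by (rule sq_integrable_cmult[OF R])
  have \<sigma>2: "\<sigma>\<^sup>2 = variance H" using \<sigma> by simp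
  have "expectation (\<lambda>\<omega>. (D \<omega>)\<^sup>2) = c\<^sup>2 / (J\<^sup>2 * \<sigma>\<^sup>2) * expectation (\<lambda>\<omega>. (R \<omega>)\<^sup>2)"
    by (simp add: D power_mult_distrib power_divide)
  also have "expectation (\<lambda>\<omega>. (R \<omega>)\<^sup>2) = variance X - (J / c)\<^sup>2 * \<sigma>\<^sup>2"
    using variance_orthogonal_decomposition[OF X H mean orth] by (simp add: R_def \<sigma>2)
  \<comment> \<open>For \<open>\<sigma> = 0\<close> the left side is 0 while the ratio minus 1 is
    -1; the maximum with 0 covers this case.\<close>
  also have "c\<^sup>2 / (J\<^sup>2 * \<sigma>\<^sup>2) * (variance X - (J / c)\<^sup>2 * \<sigma>\<^sup>2) \<le> max 0 (variance X / (J\<^sup>2 / c\<^sup>2 * \<sigma>\<^sup>2) - 1)"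
  proof (cases "\<sigma> = 0")
    case False
    with \<open>J \<noteq> 0\<close> \<open>c > 0\<close> have "c\<^sup>2 / (J\<^sup>2 * \<sigma>\<^sup>2) * (variance X - (J / c)\<^sup>2 * \<sigma>\<^sup>2) = variance X / (J\<^sup>2 / c\<^sup>2 * \<sigma>\<^sup>2) - 1"
      by (simp add: field_simps)
    then show ?thesis by simp
  qed simp
  finally show "expectation (\<lambda>\<omega>. (D \<omega>)\<^sup>2) \<le> max 0 (variance X / (J\<^sup>2 / c\<^sup>2 * \<sigma>\<^sup>2) - 1)" .
qed

section \<open>The random field and its region of integration\<close>

lemma gaussian_field_standard_pair:
  assumes Z: "gaussian_field M Z" and mean: "\<And>p. expectation (Z p) = 0"
    and var: "\<And>p. expectation (\<lambda>\<omega>. (Z p \<omega>)\<^sup>2) = 1"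
  shows "standard_gaussian_pair (Z p) (Z q) (expectation (\<lambda>\<omega>. Z p \<omega> * Z q \<omega>))"
proof -
  have "gaussian_rv M (\<lambda>\<omega>. a * Z p \<omega> + b * Z q \<omega>)" for a b
  \<comment> \<open>For \<open>p = q\<close> the index set \<open>{p, q}\<close> has one element, so
    the two coefficients must be added beforehand.\<close>
  proof (cases "p = q")
    case True
    have "gaussian_rv M (\<lambda>\<omega>. \<Sum>r\<in>{p}. (a + b) * Z r \<omega>)"
      using Z[unfolded gaussian_field_def, rule_format, of "{p}" "\<lambda>_. a + b"] by simp
    with True show ?thesis by (simp add: distrib_right)
  next
    case False
    have "gaussian_rv M (\<lambda>\<omega>. \<Sum>r\<in>{p, q}. (if r = p then a else b) * Z r \<omega>)"
      using Z[unfolded gaussian_field_def, rule_format, of "{p, q}" "\<lambda>r. if r = p then a else b"] by simp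
    with False show ?thesis by simp
  qed
  with mean var show ?thesis by (simp add: standard_gaussian_pair_def)
qed

text \<open>Stationarity reduces the uniform mean-square continuity to continuity at the origin.\<close>

lemma stationary_uniform_ms_continuity:
  fixes Z :: "'x::euclidean_space \<times> real \<Rightarrow> 'a \<Rightarrow> real"
  assumes ms: "ms_continuous_field M Z"
    and var: "\<And>p. expectation (\<lambda>\<omega>. (Z p \<omega>)\<^sup>2) = 1"
    and cov: "\<And>x y t s. expectation (\<lambda>\<omega>. Z (x, t) \<omega> * Z (y, s) \<omega>) = C (norm (x - y)) \<bar>t - s\<bar>"
    and "\<epsilon> > 0"
  shows "\<exists>\<delta>>0. \<forall>p q. dist p q < \<delta> \<longrightarrow> expectation (\<lambda>\<omega>. (Z p \<omega> - Z q \<omega>)\<^sup>2) < \<epsilon>"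
proof -
  have sq: "sq_integrable M (Z p)" for p
    using ms unfolding ms_continuous_field_def sq_integrable_def by blast
  \<comment> \<open>Unit variances make the squared increment a function of the spatial distance and
    the time lag alone, so \<open>p\<close> and \<open>q\<close> may be replaced by
    \<open>p - q\<close> and 0.\<close>
  have eq: "expectation (\<lambda>\<omega>. (Z p \<omega> - Z q \<omega>)\<^sup>2) = 2 - 2 * C (norm (fst p - fst q)) \<bar>snd p - snd q\<bar>" for p q
  proof -
    have "expectation (\<lambda>\<omega>. (Z p \<omega> - Z q \<omega>)\<^sup>2) =
        expectation (\<lambda>\<omega>. (Z p \<omega>)\<^sup>2 + (Z q \<omega>)\<^sup>2 - 2 * (Z p \<omega> * Z q \<omega>))"
      by (simp add: power2_diff mult.assoc)
    also have "\<dots> = 2 - 2 * expectation (\<lambda>\<omega>. Z p \<omega> * Z q \<omega>)"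
      using sq_integrable_square[OF sq] integrable_mult_sq_integrable[OF sq sq] by (simp add: var)
    finally show ?thesis using cov[of "fst p" "snd p" "fst q" "snd q"] by simp
  qed
  have "((\<lambda>q. expectation (\<lambda>\<omega>. (Z q \<omega> - Z 0 \<omega>)\<^sup>2)) \<longlongrightarrow> 0) (at 0)"
    using ms unfolding ms_continuous_field_def by blast
  then have "\<forall>\<^sub>F q in at 0. expectation (\<lambda>\<omega>. (Z q \<omega> - Z 0 \<omega>)\<^sup>2) < \<epsilon>"
    using \<open>\<epsilon> > 0\<close> by (intro order_tendstoD(2)) auto
  then obtain \<delta> where "\<delta> > 0" and \<delta>: "\<And>q. q \<noteq> 0 \<Longrightarrow> dist q 0 < \<delta> \<Longrightarrow> expectation (\<lambda>\<omega>. (Z q \<omega> - Z 0 \<omega>)\<^sup>2) < \<epsilon>"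
    by (auto simp: eventually_at)
  have "expectation (\<lambda>\<omega>. (Z p \<omega> - Z q \<omega>)\<^sup>2) < \<epsilon>" if "dist p q < \<delta>" for p q
  proof (cases "p = q")
    case False
    have "expectation (\<lambda>\<omega>. (Z p \<omega> - Z q \<omega>)\<^sup>2) = expectation (\<lambda>\<omega>. (Z (p - q) \<omega> - Z 0 \<omega>)\<^sup>2)"
      by (simp add: eq fst_diff snd_diff)
    also have "\<dots> < \<epsilon>"
      using False that by (intro \<delta>) (simp_all add: dist_norm)
    finally show ?thesis .
  qed (use \<open>\<epsilon> > 0\<close> in simp)
  with \<open>\<delta> > 0\<close> show ?thesis by blast
qed

end

lemma compact_space_time_region:
  assumes "compact K"
  shows "compact (space_time_region K \<gamma> T)"
  unfolding space_time_region_def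
  by (intro compact_Times compact_Icc compact_continuous_image continuous_intros assms)

theorem theorem3:
  fixes M :: "'w measure"
    and Z :: "(real ^ 'n) \<times> real \<Rightarrow> 'w \<Rightarrow> real"
    and K :: "(real ^ 'n) set"
    and C :: "real \<Rightarrow> real \<Rightarrow> real"
    and G :: "real \<Rightarrow> real \<Rightarrow> real"
    and A Y Y\<^sub>m :: "real \<Rightarrow> 'w \<Rightarrow> real"
    and \<sigma> J :: "real \<Rightarrow> real"
    and \<gamma> :: real and m :: nat
  assumes "prob_space M"
    and "CARD('n) \<ge> 2"
    and "convex_body K" and "0 \<in> K"
    and "\<gamma> \<ge> 0"
    and "gaussian_field M Z"
    and "measurable_field M Z"
    and "ms_continuous_field M Z"
    and "homogeneous_in_space M Z"
    and "isotropic_in_space M Z"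
    and "stationary_in_time M Z"
    and "\<And>p. prob_space.expectation M (Z p) = 0"
    and "\<And>p. prob_space.expectation M (\<lambda>\<omega>. (Z p \<omega>)\<^sup>2) = 1"
    and "\<And>x y t s. prob_space.expectation M (\<lambda>\<omega>. Z (x, t) \<omega> * Z (y, s) \<omega>) = C (norm (x - y)) \<bar>t - s\<bar>"
    and "\<And>x y t s. C (norm (x - y :: real ^ 'n)) \<bar>t - s\<bar> \<ge> 0"
    and "m \<ge> 1"
    and "\<And>T. T > 0 \<Longrightarrow> L2_gauss (G T)"
    and "\<And>T. T > 0 \<Longrightarrow> has_hermite_rank (G T) m"
    and J: "\<And>T. T > 0 \<Longrightarrow> J T = hermite_coeff (G T) m"
    and \<sigma>: "\<And>T. T > 0 \<Longrightarrow> \<sigma> T = sqrt (hermite_variance M Z K \<gamma> m T)"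
    and A: "\<And>T. T > 0 \<Longrightarrow> A T = field_functional M Z K \<gamma> (G T) T"
    and "Limsup at_top (\<lambda>T. ereal (prob_space.variance M (A T) /
           ((J T)\<^sup>2 / (fact m)\<^sup>2 * (\<sigma> T)\<^sup>2))) \<le> 1"
    and Y: "\<And>T \<omega>. T > 0 \<Longrightarrow>
           Y T \<omega> = (A T \<omega> - prob_space.expectation M (A T)) / (\<bar>J T\<bar> * \<sigma> T / fact m)"
    and Y\<^sub>m: "\<And>T \<omega>. T > 0 \<Longrightarrow>
           Y\<^sub>m T \<omega> = sgn (J T) * field_functional M Z K \<gamma> (hermite m) T \<omega> / \<sigma> T"
  shows "same_limit_distributions M Y Y\<^sub>m"
proof -
  interpret prob_space M by fact
  note mean = \<open>\<And>p. expectation (Z p) = 0\<close>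
    and var = \<open>\<And>p. expectation (\<lambda>\<omega>. (Z p \<omega>)\<^sup>2) = 1\<close>
    and cov = \<open>\<And>x y t s. expectation (\<lambda>\<omega>. Z (x, t) \<omega> * Z (y, s) \<omega>) = C (norm (x - y)) \<bar>t - s\<bar>\<close>
  have pair: "standard_gaussian_pair (Z p) (Z q) (expectation (\<lambda>\<omega>. Z p \<omega> * Z q \<omega>))" for p q
    using gaussian_field_standard_pair[OF \<open>gaussian_field M Z\<close> mean var] .
  note marg = standard_gaussian_pair_marginal(1,3)[OF pair]
  define S where "S T = space_time_region K \<gamma> T" for T
  have S: "compact (S T)" for T
    using \<open>convex_body K\<close> by (simp add: S_def compact_space_time_region convex_body_def)
  define H where "H T = field_functional M Z K \<gamma> (hermite m) T" for T
  \<comment> \<open>Exhibiting the pathwise integral justifies the choice in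
    \<open>ms_integral\<close>; from here on \<open>field_functional\<close> is a genuine
    mean-square integral.\<close>
  have ms: "has_ms_integral M (\<lambda>p \<omega>. g (Z p \<omega>)) (S T) (field_functional M Z K \<gamma> g T)"
    if g: "L2_gauss g" for g T
  proof -
    have [measurable]: "g \<in> borel_measurable borel" using g by (simp add: L2_gauss_def)
    have "(\<lambda>(p, \<omega>). Z p \<omega>) \<in> borel_measurable (borel \<Otimes>\<^sub>M M)"
      using \<open>measurable_field M Z\<close> by (simp add: measurable_field_def)
    then have meas: "(\<lambda>(p, \<omega>). g (Z p \<omega>)) \<in> borel_measurable (borel \<Otimes>\<^sub>M M)"
      unfolding case_prod_beta' by measurable
    have cont: "\<exists>\<delta>>0. \<forall>p\<in>S T. \<forall>q\<in>S T. dist p q < \<delta> \<longrightarrow> expectation (\<lambda>\<omega>. (g (Z p \<omega>) - g (Z q \<omega>))\<^sup>2) < \<epsilon>"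
      if "\<epsilon> > 0" for \<epsilon>
    proof -
      obtain \<eta> where "\<eta> > 0" and *: "\<forall>X Y. X \<in> borel_measurable M \<longrightarrow> Y \<in> borel_measurable M \<longrightarrow>
          distr M borel X = std_normal_distribution \<longrightarrow> distr M borel Y = std_normal_distribution \<longrightarrow>
          expectation (\<lambda>\<omega>. (X \<omega> - Y \<omega>)\<^sup>2) < \<eta> \<longrightarrow> expectation (\<lambda>\<omega>. (g (X \<omega>) - g (Y \<omega>))\<^sup>2) < \<epsilon>"
        using standard_normal_uniform_L2_continuity[OF g \<open>\<epsilon> > 0\<close>] by meson
      have \<eta>: "expectation (\<lambda>\<omega>. (g (Z p \<omega>) - g (Z q \<omega>))\<^sup>2) < \<epsilon>"
        if "expectation (\<lambda>\<omega>. (Z p \<omega> - Z q \<omega>)\<^sup>2) < \<eta>" for p q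
        using *[rule_format, OF marg(1) marg(1) marg(2) marg(2) that] .
      obtain \<delta> where "\<delta> > 0" "\<forall>p q. dist p q < \<delta> \<longrightarrow> expectation (\<lambda>\<omega>. (Z p \<omega> - Z q \<omega>)\<^sup>2) < \<eta>"
        using stationary_uniform_ms_continuity[OF \<open>ms_continuous_field M Z\<close> var cov \<open>\<eta> > 0\<close>] by blast
      with \<eta> show ?thesis by blast
    qed
    have "has_ms_integral M (\<lambda>p \<omega>. g (Z p \<omega>)) (S T) (\<lambda>\<omega>. LINT p|restrict_space lborel (S T). g (Z p \<omega>))"
      using sq_integrable_L2_gauss[OF marg g]
      by (intro has_ms_integral_pathwise[OF prob_space_axioms S meas _ _ cont,
            where b = "LINT z|lborel. (g z)\<^sup>2 * std_normal_density z"]) auto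
    then show ?thesis
      unfolding field_functional_def ms_integral_def S_def
      by (rule someI[of "has_ms_integral M (\<lambda>p \<omega>. g (Z p \<omega>)) (space_time_region K \<gamma> T)"])
  qed
  have diff: "sq_integrable M (\<lambda>\<omega>. Y T \<omega> - Y\<^sub>m T \<omega>)"
    "expectation (\<lambda>\<omega>. (Y T \<omega> - Y\<^sub>m T \<omega>)\<^sup>2) \<le>
      max 0 (variance (A T) / ((J T)\<^sup>2 / (fact m)\<^sup>2 * (\<sigma> T)\<^sup>2) - 1)"
    "Y T \<in> borel_measurable M" "Y\<^sub>m T \<in> borel_measurable M" if "T > 0" for T
  proof -
    have G: "L2_gauss (G T)" and "J T \<noteq> 0"
      using that J assms(17,18) by (auto simp: has_hermite_rank_def)
    have mA: "has_ms_integral M (\<lambda>p \<omega>. G T (Z p \<omega>)) (S T) (A T)"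
      and mH: "has_ms_integral M (\<lambda>p \<omega>. hermite m (Z p \<omega>)) (S T) (H T)"
      unfolding A[OF that] H_def by (intro ms G L2_gauss_hermite)+
    note sA = has_ms_integral_sq_integrable[OF mA] and sH = has_ms_integral_sq_integrable[OF mH]
    note proj = ms_integral_hermite_projection[OF pair S G \<open>m \<ge> 1\<close> mA mH, folded J[OF that]]
    have \<sigma>': "\<sigma> T = sqrt (variance (H T))"
      by (simp add: \<sigma>[OF that] hermite_variance_def H_def)
    note nd = normalised_difference_L2[OF sA sH proj \<open>J T \<noteq> 0\<close> _ \<sigma>']
    show "sq_integrable M (\<lambda>\<omega>. Y T \<omega> - Y\<^sub>m T \<omega>)"
      "expectation (\<lambda>\<omega>. (Y T \<omega> - Y\<^sub>m T \<omega>)\<^sup>2) \<le>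
        max 0 (variance (A T) / ((J T)\<^sup>2 / (fact m)\<^sup>2 * (\<sigma> T)\<^sup>2) - 1)"
      unfolding Y[OF that] Y\<^sub>m[OF that] H_def[symmetric] using nd by simp_all
    have [measurable]: "A T \<in> borel_measurable M" "H T \<in> borel_measurable M"
      using sA sH by (auto dest: sq_integrable_measurable)
    show "Y T \<in> borel_measurable M" "Y\<^sub>m T \<in> borel_measurable M"
      using Y[OF that] Y\<^sub>m[OF that] by (simp_all add: H_def[symmetric] cong: measurable_cong)
  qed
  have lim: "((\<lambda>T. expectation (\<lambda>\<omega>. (Y T \<omega> - Y\<^sub>m T \<omega>)\<^sup>2)) \<longlongrightarrow> 0) at_top"
  proof (rule tendstoI)
    fix \<epsilon> :: real assume "\<epsilon> > 0"
    \<comment> \<open>The upper limit keeps the variance ratio eventually below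
      \<open>1 + \<epsilon>\<close>. An upper bound suffices, as the mean squared difference is
      nonnegative.\<close>
    then have "1 < ereal (1 + \<epsilon>)" by (simp add: one_ereal_def)
    then have "\<forall>\<^sub>F T in at_top. ereal (variance (A T) / ((J T)\<^sup>2 / (fact m)\<^sup>2 * (\<sigma> T)\<^sup>2)) < ereal (1 + \<epsilon>)"
      using assms(22) by (intro Limsup_lessD) (rule le_less_trans)
    with eventually_gt_at_top[of 0]
    show "\<forall>\<^sub>F T in at_top. dist (expectation (\<lambda>\<omega>. (Y T \<omega> - Y\<^sub>m T \<omega>)\<^sup>2)) 0 < \<epsilon>"
    proof eventually_elim
      case (elim T)
      then have "max 0 (variance (A T) / ((J T)\<^sup>2 / (fact m)\<^sup>2 * (\<sigma> T)\<^sup>2) - 1) < \<epsilon>"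
        using \<open>\<epsilon> > 0\<close> by simp
      with diff(2)[OF elim(1)] have "expectation (\<lambda>\<omega>. (Y T \<omega> - Y\<^sub>m T \<omega>)\<^sup>2) < \<epsilon>"
        by (rule le_less_trans)
      then show ?case by (simp add: dist_real_def)
    qed
  qed
  have ev: "\<forall>\<^sub>F T in at_top. Y T \<in> borel_measurable M \<and> Y\<^sub>m T \<in> borel_measurable M \<and>
      sq_integrable M (\<lambda>\<omega>. Y T \<omega> - Y\<^sub>m T \<omega>)"
    using eventually_gt_at_top[of 0] by eventually_elim (use diff in blast)
  \<comment> \<open>The transfer lemma goes in one direction, so the equivalence of the limits
    requires its premises with the two families exchanged.\<close>
  have ev': "\<forall>\<^sub>F T in at_top. Y\<^sub>m T \<in> borel_measurable M \<and> Y T \<in> borel_measurable M \<and>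
      sq_integrable M (\<lambda>\<omega>. Y\<^sub>m T \<omega> - Y T \<omega>)"
    using ev
  proof eventually_elim
    case (elim T)
    then show ?case
      using sq_integrable_cmult[of M "\<lambda>\<omega>. Y T \<omega> - Y\<^sub>m T \<omega>" "-1"] by simp
  qed
  have lim': "((\<lambda>T. expectation (\<lambda>\<omega>. (Y\<^sub>m T \<omega> - Y T \<omega>)\<^sup>2)) \<longlongrightarrow> 0) at_top"
    using lim by (simp add: power2_commute[of "Y\<^sub>m _ _"])
  show ?thesis
    unfolding same_limit_distributions_def
    using weak_conv_filter_L2_close[OF ev lim] weak_conv_filter_L2_close[OF ev' lim'] by blast
qed

end
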